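(* Let $k$ be a field of characteristic $0$, let $R$ be a finite field extension of $k$, let $A=R[\mathcal S,\mathcal D;\sigma,\delta]$ be a differential difference algebra of type $(m,n)$ over $R$, and put $l=m+n$. Let $N$ be a submodule of the free left $A$-module $A^p$ ($p\ge1$), and let $G$ be a finite left Gröbner-Shirshov basis for $N$ with respect to a total degree DD-monomial ordering on the monomials of $A^p$. Let $M=A^p/N$ and set $q=\max\{\operatorname{tdeg}_{x_i}(\operatorname{lm}(g)):g\in G,\ 1\le i\le l\}$. Then: (i) There exists a unique polynomial $h\in\mathbb Q[x]$ such that the Hilbert function $\operatorname{HF}_M$ of $M$ satisfies $\operatorname{HF}_M(t)=h(t)$ for all integers $t\ge lq$. (ii) The Gelfand-Kirillov dimension of $M$ is equal to the degree of $h$, which is given by $$\operatorname{GKdim}(M)=\deg h=\max\{|\operatorname{top}_q(u)|:u\in\operatorname{Irr}(G)\cap\mathcal N_{\le t},\ \operatorname{sh}_q(u)=u\},\qquad t\ge lq.$$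
   Context: All algebras are unital associative $k$-algebras; $\mathbb N$ includes $0$. A derivation on an algebra $R$ is a $k$-linear map $\delta$ with $\delta(ab)=a\delta(b)+\delta(a)b$. $R\langle a_1,\dots,a_s\rangle$ denotes the subalgebra generated by $R$ and $a_1,\dots,a_s$. Differential difference algebra: an algebra $A$ is a differential difference algebra of type $(m,n)$ ($m,n\in\mathbb N$) over a subalgebra $R\subseteq A$, written $A=R[\mathcal S,\mathcal D;\sigma,\delta]$, if there are elements $S_1,\dots,S_m,D_1,\dots,D_n\in A$ such that: (i) the elements $S_1^{\alpha_1}\cdots S_m^{\alpha_m}D_1^{\beta_1}\cdots D_n^{\beta_n}$ ($\alpha_i,\beta_j\in\mathbb N$) form a basis of $A$ as a free left $R$-module; (ii) $D_ir=rD_i+\delta_i(r)$ for $r\in R$, $1\le i\le n$, with $\delta_i$ a derivation on $R$; (iii) $S_ir=\sigma_i^{-1}(r)S_i$ (equivalently $rS_i=S_i\sigma_i(r)$) for $r\in R$, $1\le i\le m$, where $\sigma_i$ is a $k$-algebra automorphism of $R\langle D_1,\dots,D_n\rangle$ restricting to an automorphism of $R$ and with $\sigma_i(D_j)=\sum_{s=1}^n a_{ijs}D_s$, $a_{ijs}\in R$; (iv) $D_iS_j=S_j\sigma_j(D_i)$; (v) the $S_i$ commute with each other and the $D_j$ commute with each other; (vi) the $\delta_i$ commute with each other and the $\sigma_i$ commute with each other. These elements are fixed. Notation: $x_i=S_i$ ($1\le i\le m$), $x_{m+j}=D_j$ ($1\le j\le n$), $X^\alpha=x_1^{\alpha_1}\cdots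 x_l^{\alpha_l}$ for $\alpha\in\mathbb N^l$, $|\alpha|=\sum\alpha_i$. Let $e_1,\dots,e_p$ be the standard basis of $A^p$. Monomials of $A^p$: $\mathcal N=\{X^\alpha e_i:\alpha\in\mathbb N^l,1\le i\le p\}$ (an $R$-basis of $A^p$). $\operatorname{tdeg}(X^\alpha e_i)=|\alpha|$, $\operatorname{tdeg}_{x_j}(X^\alpha e_i)=\alpha_j$; $\mathcal N_{\le t}=\{u\in\mathcal N:\operatorname{tdeg}u\le t\}$. For $0\ne f\in A^p$ and a total order on $\mathcal N$, $\operatorname{lm}(f)$ is the largest monomial occurring in $f$ with nonzero coefficient. $X^\alpha e_i$ is right divisible by $X^\beta e_j$ iff $i=j$ and $\alpha_s\ge\beta_s$ for all $s$ (equivalently, iff $i=j$ and $X^\alpha=hX^\beta$ for some $h\in A$). A DD-monomial ordering on $\mathcal N$ is a (total) well-ordering $>$ such that $u>v$ implies $\operatorname{lm}(fu)>\operatorname{lm}(fv)$ for all $u,v\in\mathcal N$ and $0\neq f\in A$; it is a total degree ordering if $u>v$ whenever $\operatorname{tdeg}u>\operatorname{tdeg}v$. A subset $G\subseteq N$ (of nonzero elements) is a left Gröbner-Shirshov basis for $N$ if for every $0\ne f\in N$ there is $g\in G$ with $\operatorname{lm}(f)$ right divisible by $\operatorname{lm}(g)$. $\operatorname{Irr}(G)$ is the set of $w\in\mathcal N$ not right divisible by $\operatorname{lm}(g)$ for any $g\in G$. For $u=X^\alpha e_i$ and $q\in\mathbb N$: $\operatorname{top}_q(u)=\{j:1\le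 j\le l,\ \alpha_j\ge q\}$; $\operatorname{sh}_q(u)=X^\beta e_i$ with $\beta_j=\min\{q,\alpha_j\}$. Let $A_i$ be the $R$-subspace of $A$ spanned by $\{X^\alpha:|\alpha|=i\}$, let $E$ be the $k$-subspace of $M$ spanned by $e_1+N,\dots,e_p+N$, and $M_i=A_iE$. The Hilbert function of $M$ is $\operatorname{HF}_M(i)=\dim_k(M_0+\cdots+M_i)$. The Gelfand-Kirillov dimension of a left $A$-module $M$ is $\operatorname{GKdim}(M)=\sup_{V,F}\limsup_{n\to\infty}\log_n\dim_k(V^nF)$, the supremum over all finite-dimensional subspaces $V\subseteq A$ containing $1$ and finite-dimensional subspaces $F\subseteq M$. Conventions: if the set defining $q$ is empty then $q=0$; for $M=0$ one has $h=0$, and $\deg 0$, the maximum of the empty set in (ii), and $\operatorname{GKdim}(0)$ are all $-\infty$ (with $\log_n 0=-\infty$). *)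

theory Defs
  imports
    "HOL-Analysis.Cartesian_Space"
    "HOL-Library.Extended_Real"
    "HOL-Computational_Algebra.Polynomial"
    "Jordan_Normal_Form.Missing_VectorSpace"
begin

section \<open>Algebras over a field\<close>

text \<open>
  The algebra is a type \<open>'a\<close> of class \<open>ring_1\<close>, the field \<open>k\<close> is a type \<open>'k\<close> acting by \<open>scale\<close>.
  Subalgebras, and maps defined on them, are sets of and total functions on \<open>'a\<close>; a map is only
  ever constrained on the subalgebra it is meant for.
\<close>

locale k_algebra = vector_space scale
  for scale :: "'k::field \<Rightarrow> 'a::ring_1 \<Rightarrow> 'a" +
  assumes scale_mult_left: "scale c (a * b) = scale c a * b"
    and scale_mult_right: "scale c (a * b) = a * scale c b"
begin

definition subalgebra :: "'a set \<Rightarrow> bool" where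
  "subalgebra B \<longleftrightarrow> subspace B \<and> 1 \<in> B \<and> (\<forall>a\<in>B. \<forall>b\<in>B. a * b \<in> B)"

definition generated_subalgebra :: "'a set \<Rightarrow> 'a set" where
  "generated_subalgebra X = \<Inter> {B. subalgebra B \<and> X \<subseteq> B}"

definition derivation_on :: "'a set \<Rightarrow> ('a \<Rightarrow> 'a) \<Rightarrow> bool" where
  "derivation_on B d \<longleftrightarrow>
     (\<forall>a\<in>B. d a \<in> B) \<and>
     (\<forall>a\<in>B. \<forall>b\<in>B. d (a + b) = d a + d b) \<and>
     (\<forall>c. \<forall>a\<in>B. d (scale c a) = scale c (d a)) \<and>
     (\<forall>a\<in>B. \<forall>b\<in>B. d (a * b) = a * d b + d a * b)"

definition automorphism_on :: "'a set \<Rightarrow> ('a \<Rightarrow> 'a) \<Rightarrow> bool" where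
  "automorphism_on B s \<longleftrightarrow>
     bij_betw s B B \<and> s 1 = 1 \<and>
     (\<forall>a\<in>B. \<forall>b\<in>B. s (a + b) = s a + s b) \<and>
     (\<forall>a\<in>B. \<forall>b\<in>B. s (a * b) = s a * s b) \<and>
     (\<forall>c. \<forall>a\<in>B. s (scale c a) = scale c (s a))"

definition finite_field_extension :: "'a set \<Rightarrow> bool" where
  "finite_field_extension R \<longleftrightarrow>
     subalgebra R \<and>
     (\<forall>a\<in>R. \<forall>b\<in>R. a * b = b * a) \<and>
     (\<forall>a\<in>R. a \<noteq> 0 \<longrightarrow> (\<exists>b\<in>R. a * b = 1)) \<and>
     (\<exists>B. finite B \<and> R = span B)"

text \<open>\<open>V\<^sup>n\<close> is the \<open>k\<close>-span of the \<open>n\<close>-fold products of elements of \<open>V\<close>.\<close>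

primrec subspace_power :: "'a set \<Rightarrow> nat \<Rightarrow> 'a set" where
  "subspace_power V 0 = span {1}"
| "subspace_power V (Suc n) = span {v * w | v w. v \<in> V \<and> w \<in> subspace_power V n}"

end


section \<open>Left modules, dimension and Gelfand-Kirillov dimension\<close>

text \<open>
  A left module over the type \<open>'a\<close> is a record \<open>('a, 'm) module\<close>, of which only the fields
  \<open>carrier\<close>, \<open>zero\<close>, \<open>add\<close> and \<open>smult\<close> matter. (The locale of the same name is about
  commutative scalar rings and is used for the \<open>k\<close>-structure only.)
\<close>

abbreviation scalar_ring :: "'k::field ring" where
  "scalar_ring \<equiv> \<lparr>carrier = UNIV, mult = (*), one = 1, zero = 0, add = (+)\<rparr>"

text \<open>\<open>log\<^sub>n d\<close> with \<open>log\<^sub>n 0 = -\<infinity>\<close>; \<^const>\<open>log\<close> has the value 0 there.\<close>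

definition elog :: "nat \<Rightarrow> nat \<Rightarrow> ereal" where
  "elog n d = (if d = 0 then -\<infinity> else ereal (log (real n) (real d)))"

context k_algebra
begin

definition k_space :: "('a, 'm) module \<Rightarrow> ('k, 'm) module" where
  "k_space M = \<lparr>carrier = carrier M, mult = mult M, one = one M, zero = zero M, add = add M,
                smult = (\<lambda>c v. smult M (scale c 1) v)\<rparr>"

definition k_span :: "('a, 'm) module \<Rightarrow> 'm set \<Rightarrow> 'm set" where
  "k_span M X = LinearCombinations.module.span scalar_ring (k_space M) X"

definition k_dim :: "('a, 'm) module \<Rightarrow> 'm set \<Rightarrow> nat" where
  "k_dim M W = vectorspace.dim scalar_ring ((k_space M)\<lparr>carrier := W\<rparr>)"

definition product_space :: "('a, 'm) module \<Rightarrow> 'a set \<Rightarrow> 'm set \<Rightarrow> 'm set" where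
  "product_space M V F = k_span M {smult M a f | a f. a \<in> V \<and> f \<in> F}"

definition GKdim :: "('a, 'm) module \<Rightarrow> ereal" where
  "GKdim M =
     (SUP (V, F) \<in> {(V, F). 1 \<in> V \<and> (\<exists>B. finite B \<and> V = span B) \<and>
                            (\<exists>C. finite C \<and> C \<subseteq> carrier M \<and> F = k_span M C)}.
        limsup (\<lambda>n. elog n (k_dim M (product_space M (subspace_power V n) F))))"

end


section \<open>The free module \<open>A\<^sup>p\<close> and its quotients\<close>

text \<open>
  \<open>A\<^sup>p\<close> is the type \<open>'a ^ 'p\<close>, with the left action \<^term>\<open>a *s f\<close>; its standard basis vectors are
  \<^term>\<open>axis i 1\<close>.
\<close>

definition left_submodule :: "('a::ring_1 ^ 'p) set \<Rightarrow> bool" where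
  "left_submodule N \<longleftrightarrow> 0 \<in> N \<and> (\<forall>f\<in>N. \<forall>g\<in>N. f + g \<in> N) \<and> (\<forall>a. \<forall>f\<in>N. a *s f \<in> N)"

definition coset :: "('a::ring_1 ^ 'p) set \<Rightarrow> 'a ^ 'p \<Rightarrow> ('a ^ 'p) set" where
  "coset N f = {f + g | g. g \<in> N}"

definition quotient_module :: "('a::ring_1 ^ 'p) set \<Rightarrow> ('a, ('a ^ 'p) set) module" where
  "quotient_module N =
     \<lparr>carrier = range (coset N), mult = undefined, one = undefined,
      zero = N,
      add = (\<lambda>X Y. {f + g | f g. f \<in> X \<and> g \<in> Y}),
      smult = (\<lambda>a X. \<Union>f\<in>X. coset N (a *s f))\<rparr>"

text \<open>The operations are the expected ones, and the \<open>k\<close>-structure is a vector space.\<close>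

lemma coset_eq_iff:
  assumes "left_submodule N"
  shows "coset N f = coset N g \<longleftrightarrow> f - g \<in> N"
proof
  assume eq: "coset N f = coset N g"
  have "f \<in> coset N f"
    using assms by (force simp: coset_def left_submodule_def)
  then show "f - g \<in> N"
    unfolding eq by (auto simp: coset_def)
next
  assume *: "f - g \<in> N"
  have "(- 1) *s (f - g) \<in> N"
    using assms * unfolding left_submodule_def by blast
  moreover have "(- 1) *s (f - g) = g - f"
    by (simp add: vec_eq_iff)
  ultimately have **: "g - f \<in> N" by simp
  have "f + h = g + ((f - g) + h)" "g + h = f + ((g - f) + h)" for h by simp_all
  then show "coset N f = coset N g"
    using assms * ** unfolding coset_def left_submodule_def by blast
qed

lemma quotient_module_add:
  assumes "left_submodule N"
  shows "add (quotient_module N) (coset N f) (coset N g) = coset N (f + g)"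
proof -
  have "\<exists>h. (f + a) + (g + b) = f + g + h \<and> h \<in> N" if "a \<in> N" "b \<in> N" for a b
    using that assms by (intro exI[of _ "a + b"]) (auto simp: left_submodule_def)
  moreover have "\<exists>a b. f + g + h = a + b \<and> (\<exists>c. a = f + c \<and> c \<in> N) \<and> (\<exists>c. b = g + c \<and> c \<in> N)"
    if "h \<in> N" for h
    using that assms by (intro exI[of _ "f + h"] exI[of _ "g + 0"]) (auto simp: left_submodule_def)
  ultimately show ?thesis
    by (auto simp: quotient_module_def coset_def)
qed

lemma quotient_module_smult:
  assumes "left_submodule N"
  shows "smult (quotient_module N) a (coset N f) = coset N (a *s f)"
proof -
  have eq: "coset N (a *s g) = coset N (a *s f)" if "g \<in> coset N f" for g
  proof -
    obtain h where h: "h \<in> N" "g = f + h"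
      using \<open>g \<in> coset N f\<close> by (auto simp: coset_def)
    have "a *s h \<in> N"
      using assms h(1) unfolding left_submodule_def by blast
    moreover have "a *s g - a *s f = a *s h"
      unfolding h(2) by (simp add: vec_eq_iff distrib_left)
    ultimately show ?thesis
      by (simp only: coset_eq_iff[OF assms])
  qed
  have "f + 0 \<in> coset N f"
    using assms unfolding left_submodule_def coset_def by blast
  then have "f \<in> coset N f" by simp
  with eq have "(\<Union>g\<in>coset N f. coset N (a *s g)) = coset N (a *s f)"
    by blast
  then show ?thesis
    by (simp add: quotient_module_def)
qed

lemma quotient_module_zero:
  "zero (quotient_module N) = coset N 0"
  by (auto simp: quotient_module_def coset_def)

lemma (in k_algebra) vectorspace_quotient:
  fixes N :: "('a ^ 'p::finite) set"
  assumes N: "left_submodule N"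
  shows "vectorspace scalar_ring (k_space (quotient_module N))"
proof -
  let ?Q = "k_space (quotient_module N)"
  let ?K = "scalar_ring :: 'k ring"
  have c: "carrier ?Q = range (coset N)"
    by (simp add: k_space_def quotient_module_def)
  have add: "add ?Q (coset N f) (coset N g) = coset N (f + g)" for f g
    using quotient_module_add[OF N] by (simp add: k_space_def)
  have zero: "zero ?Q = coset N 0"
    by (simp add: k_space_def quotient_module_zero)
  have smult: "Module.module.smult ?Q a (coset N f) = coset N (scale a 1 *s f)" for a f
    using quotient_module_smult[OF N] by (simp add: k_space_def)
  have fld: "field ?K"
    apply unfold_locales
    apply (auto simp: field_simps Units_def)
    subgoal for x by (rule exI[of _ "-x"]) simp
    subgoal for x by (rule exI[of _ "inverse x"]) simp
    done
  have ab: "abelian_group ?Q"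
  proof (rule abelian_groupI)
    fix x assume "x \<in> carrier ?Q"
    then obtain f where "x = coset N f" by (auto simp: c)
    then show "\<exists>y\<in>carrier ?Q. y \<oplus>\<^bsub>?Q\<^esub> x = \<zero>\<^bsub>?Q\<^esub>"
      by (intro bexI[of _ "coset N (- f)"]) (simp_all add: c add zero)
  qed (auto simp: c add zero algebra_simps)
  have s1: "scale (a * b) 1 = scale a 1 * scale b 1" for a b
    by (metis mult_1 scale_mult_left scale_scale)
  have v1: "(u + v) *s (f :: 'a ^ 'p) = u *s f + v *s f" "u *s (f + g) = u *s f + u *s g"
     "(u * v) *s f = u *s (v *s f)" for u v f g
    by (simp_all add: vec_eq_iff algebra_simps)
  have "Module.module ?K ?Q"
    apply (rule Module.moduleI)
    using fld field.is_ring apply (meson field_def domain_def)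
    using ab apply blast
    by (auto simp: c smult add v1 s1 scale_left_distrib)
  with fld show ?thesis
    by (simp add: vectorspace_def)
qed


section \<open>Monomials\<close>

text \<open>
  Exponents \<open>\<alpha> \<in> \<nat>\<^sup>l\<close> are functions vanishing outside \<open>{1..l}\<close>. A monomial \<open>X\<^sup>\<alpha> e\<^sub>i\<close> of \<open>A\<^sup>p\<close> is
  represented by the pair \<open>(\<alpha>, i)\<close>; since the monomials form an \<open>R\<close>-basis, this is a faithful
  encoding.
\<close>

type_synonym 'p monom = "(nat \<Rightarrow> nat) \<times> 'p"

definition exps :: "nat \<Rightarrow> (nat \<Rightarrow> nat) set" where
  "exps l = {\<alpha>. \<forall>j. j \<notin> {1..l} \<longrightarrow> \<alpha> j = 0}"

definition xpow :: "nat \<Rightarrow> (nat \<Rightarrow> 'a::ring_1) \<Rightarrow> (nat \<Rightarrow> nat) \<Rightarrow> 'a" where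
  "xpow l x \<alpha> = prod_list (map (\<lambda>j. x j ^ \<alpha> j) [1..<Suc l])"

definition expansion ::
  "'a::ring_1 set \<Rightarrow> nat \<Rightarrow> (nat \<Rightarrow> 'a) \<Rightarrow> 'a \<Rightarrow> ((nat \<Rightarrow> nat) \<Rightarrow> 'a) \<Rightarrow> bool" where
  "expansion R l x a c \<longleftrightarrow>
     (\<forall>\<alpha>. c \<alpha> \<in> R) \<and> finite {\<alpha>. c \<alpha> \<noteq> 0} \<and> {\<alpha>. c \<alpha> \<noteq> 0} \<subseteq> exps l \<and>
     a = (\<Sum>\<alpha> | c \<alpha> \<noteq> 0. c \<alpha> * xpow l x \<alpha>)"

definition coeffs_of :: "'a::ring_1 set \<Rightarrow> nat \<Rightarrow> (nat \<Rightarrow> 'a) \<Rightarrow> 'a \<Rightarrow> (nat \<Rightarrow> nat) \<Rightarrow> 'a" where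
  "coeffs_of R l x a = (THE c. expansion R l x a c)"

definition monomials :: "nat \<Rightarrow> 'p monom set" where
  "monomials l = exps l \<times> UNIV"

definition monom_vec :: "nat \<Rightarrow> (nat \<Rightarrow> 'a::ring_1) \<Rightarrow> 'p::finite monom \<Rightarrow> 'a ^ 'p" where
  "monom_vec l x u = axis (snd u) (xpow l x (fst u))"

definition support :: "'a::ring_1 set \<Rightarrow> nat \<Rightarrow> (nat \<Rightarrow> 'a) \<Rightarrow> 'a ^ 'p::finite \<Rightarrow> 'p monom set" where
  "support R l x f = {u. coeffs_of R l x (f $ snd u) (fst u) \<noteq> 0}"

definition tdeg :: "nat \<Rightarrow> 'p monom \<Rightarrow> nat" where
  "tdeg l u = (\<Sum>j=1..l. fst u j)"

definition rdivides :: "'p monom \<Rightarrow> 'p monom \<Rightarrow> bool" where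
  "rdivides v u \<longleftrightarrow> snd v = snd u \<and> (\<forall>j. fst v j \<le> fst u j)"

definition top_indices :: "nat \<Rightarrow> nat \<Rightarrow> 'p monom \<Rightarrow> nat set" where
  "top_indices l q u = {j \<in> {1..l}. q \<le> fst u j}"

definition shape :: "nat \<Rightarrow> 'p monom \<Rightarrow> 'p monom" where
  "shape q u = (\<lambda>j. min q (fst u j), snd u)"


section \<open>Monomial orderings and Groebner-Shirshov bases\<close>

text \<open>
  An ordering is given as the reflexive relation \<open>r\<close> with \<open>(v, u) \<in> r\<close> meaning \<open>v \<le> u\<close>, as in
  \<^const>\<open>well_order_on\<close>.
\<close>

definition gt :: "('p monom \<times> 'p monom) set \<Rightarrow> 'p monom \<Rightarrow> 'p monom \<Rightarrow> bool" where
  "gt r u v \<longleftrightarrow> (v, u) \<in> r \<and> u \<noteq> v"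

text \<open>Only meaningful for nonzero \<open>f\<close>.\<close>

definition lm :: "'a::ring_1 set \<Rightarrow> nat \<Rightarrow> (nat \<Rightarrow> 'a) \<Rightarrow> ('p::finite monom \<times> 'p monom) set \<Rightarrow>
    'a ^ 'p \<Rightarrow> 'p monom" where
  "lm R l x r f = (THE u. u \<in> support R l x f \<and> (\<forall>v \<in> support R l x f. (v, u) \<in> r))"

definition DD_ordering ::
  "'a::ring_1 set \<Rightarrow> nat \<Rightarrow> (nat \<Rightarrow> 'a) \<Rightarrow> ('p::finite monom \<times> 'p monom) set \<Rightarrow> bool" where
  "DD_ordering R l x r \<longleftrightarrow>
     well_order_on (monomials l) r \<and>
     (\<forall>u\<in>monomials l. \<forall>v\<in>monomials l. \<forall>f. f \<noteq> 0 \<and> gt r u v \<longrightarrow>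
        gt r (lm R l x r (f *s monom_vec l x u)) (lm R l x r (f *s monom_vec l x v)))"

definition total_degree_ordering :: "nat \<Rightarrow> ('p monom \<times> 'p monom) set \<Rightarrow> bool" where
  "total_degree_ordering l r \<longleftrightarrow>
     (\<forall>u\<in>monomials l. \<forall>v\<in>monomials l. tdeg l u > tdeg l v \<longrightarrow> gt r u v)"

definition GS_basis :: "'a::ring_1 set \<Rightarrow> nat \<Rightarrow> (nat \<Rightarrow> 'a) \<Rightarrow> ('p::finite monom \<times> 'p monom) set \<Rightarrow>
    ('a ^ 'p) set \<Rightarrow> ('a ^ 'p) set \<Rightarrow> bool" where
  "GS_basis R l x r N G \<longleftrightarrow>
     G \<subseteq> N \<and> 0 \<notin> G \<and>
     (\<forall>f\<in>N. f \<noteq> 0 \<longrightarrow> (\<exists>g\<in>G. rdivides (lm R l x r g) (lm R l x r f)))"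

definition Irr :: "'a::ring_1 set \<Rightarrow> nat \<Rightarrow> (nat \<Rightarrow> 'a) \<Rightarrow> ('p::finite monom \<times> 'p monom) set \<Rightarrow>
    ('a ^ 'p) set \<Rightarrow> 'p monom set" where
  "Irr R l x r G = {w \<in> monomials l. \<forall>g\<in>G. \<not> rdivides (lm R l x r g) w}"


section \<open>Differential difference algebras\<close>

text \<open>The combined sequence \<open>x\<^sub>1, \<dots>, x\<^sub>l = S\<^sub>1, \<dots>, S\<^sub>m, D\<^sub>1, \<dots>, D\<^sub>n\<close>.\<close>

definition dd_gens :: "nat \<Rightarrow> (nat \<Rightarrow> 'a) \<Rightarrow> (nat \<Rightarrow> 'a) \<Rightarrow> nat \<Rightarrow> 'a" where
  "dd_gens m S D i = (if i \<le> m then S i else D (i - m))"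

text \<open>The commutation rule of \<open>S\<^sub>i\<close> with \<open>r\<close> is stated without the inverse of \<open>\<sigma>\<^sub>i\<close>.\<close>

locale dd_algebra = k_algebra scale
  for scale :: "'k::field \<Rightarrow> 'a::ring_1 \<Rightarrow> 'a" +
  fixes R :: "'a set" and m n :: nat and S D :: "nat \<Rightarrow> 'a"
    and \<sigma> \<delta> :: "nat \<Rightarrow> 'a \<Rightarrow> 'a"
  assumes R_subalgebra: "subalgebra R"
    and free_basis: "\<exists>!c. expansion R (m + n) (dd_gens m S D) a c"
    and derivation: "i \<in> {1..n} \<Longrightarrow> derivation_on R (\<delta> i)"
    and D_R: "\<lbrakk>i \<in> {1..n}; r \<in> R\<rbrakk> \<Longrightarrow> D i * r = r * D i + \<delta> i r"
    and automorphism: "i \<in> {1..m} \<Longrightarrow> automorphism_on (generated_subalgebra (R \<union> D ` {1..n})) (\<sigma> i)"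
    and automorphism_R: "i \<in> {1..m} \<Longrightarrow> automorphism_on R (\<sigma> i)"
    and \<sigma>_D: "\<lbrakk>i \<in> {1..m}; j \<in> {1..n}\<rbrakk> \<Longrightarrow>
      \<exists>a. (\<forall>s\<in>{1..n}. a s \<in> R) \<and> \<sigma> i (D j) = (\<Sum>s=1..n. a s * D s)"
    and R_S: "\<lbrakk>i \<in> {1..m}; r \<in> R\<rbrakk> \<Longrightarrow> r * S i = S i * \<sigma> i r"
    and D_S: "\<lbrakk>i \<in> {1..n}; j \<in> {1..m}\<rbrakk> \<Longrightarrow> D i * S j = S j * \<sigma> j (D i)"
    and S_commute: "\<lbrakk>i \<in> {1..m}; j \<in> {1..m}\<rbrakk> \<Longrightarrow> S i * S j = S j * S i"
    and D_commute: "\<lbrakk>i \<in> {1..n}; j \<in> {1..n}\<rbrakk> \<Longrightarrow> D i * D j = D j * D i"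
    and \<delta>_commute: "\<lbrakk>i \<in> {1..n}; j \<in> {1..n}; r \<in> R\<rbrakk> \<Longrightarrow> \<delta> i (\<delta> j r) = \<delta> j (\<delta> i r)"
    and \<sigma>_commute: "\<lbrakk>i \<in> {1..m}; j \<in> {1..m}; b \<in> generated_subalgebra (R \<union> D ` {1..n})\<rbrakk> \<Longrightarrow>
      \<sigma> i (\<sigma> j b) = \<sigma> j (\<sigma> i b)"


section \<open>The Hilbert function\<close>

definition left_span :: "'a::ring_1 set \<Rightarrow> 'a set \<Rightarrow> 'a set" where
  "left_span R X = {\<Sum>b\<in>T. c b * b | T c. finite T \<and> T \<subseteq> X \<and> (\<forall>b\<in>T. c b \<in> R)}"

definition graded_part :: "'a::ring_1 set \<Rightarrow> nat \<Rightarrow> (nat \<Rightarrow> 'a) \<Rightarrow> nat \<Rightarrow> 'a set" where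
  "graded_part R l x i = left_span R {xpow l x \<alpha> | \<alpha>. \<alpha> \<in> exps l \<and> (\<Sum>j=1..l. \<alpha> j) = i}"

context k_algebra
begin

definition generating_space :: "('a ^ 'p) set \<Rightarrow> ('a ^ 'p) set set" where
  "generating_space N = k_span (quotient_module N) (range (\<lambda>i. coset N (axis i 1)))"

definition Hilbert_component ::
  "'a set \<Rightarrow> nat \<Rightarrow> (nat \<Rightarrow> 'a) \<Rightarrow> ('a ^ 'p) set \<Rightarrow> nat \<Rightarrow> ('a ^ 'p) set set" where
  "Hilbert_component R l x N i =
     product_space (quotient_module N) (graded_part R l x i) (generating_space N)"

definition Hilbert_function ::
  "'a set \<Rightarrow> nat \<Rightarrow> (nat \<Rightarrow> 'a) \<Rightarrow> ('a ^ 'p) set \<Rightarrow> nat \<Rightarrow> nat" where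
  "Hilbert_function R l x N t =
     k_dim (quotient_module N)
       (k_span (quotient_module N) (\<Union>i\<le>t. Hilbert_component R l x N i))"

end


section \<open>Extended degree and maximum\<close>

definition edegree :: "'b::zero poly \<Rightarrow> ereal" where
  "edegree h = (if h = 0 then -\<infinity> else ereal (real (degree h)))"

definition emax :: "nat set \<Rightarrow> ereal" where
  "emax X = (if X = {} then -\<infinity> else ereal (real (Max X)))"

end

theory Submission
  imports Defs
begin

text \<open>
  By division, the irreducible monomials (those in \<open>Irr(G)\<close>) span, over \<open>R\<close>, a
  complement of \<open>N\<close> in \<open>A\<^sup>p\<close>. The ordering compares total degrees first, hence division does not raise
  the degree, and the complement is compatible with the degree filtration: \<open>HF\<^sub>M(t)\<close> equals
  \<open>[R : k]\<close> times the number of irreducible monomials of degree at most \<open>t\<close>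
  (\<open>normal_form\<close>, \<open>Irr_independent_mod_N\<close>, \<open>Hilbert_function_eq\<close>).

  The rest of the first part is counting. All exponents of the leading monomials of \<open>G\<close> are at most
  \<open>q\<close>, so whether \<open>u\<close> is irreducible depends only on its shape, in which the exponents are capped at
  \<open>q\<close>. There are finitely many shapes \<open>v\<close>, and the monomials of shape \<open>v\<close> and degree at most \<open>t\<close> arise
  by adding to \<open>v\<close> an arbitrary exponent, of degree at most \<open>t - |v|\<close>, on the \<open>d = |top\<^sub>q(v)|\<close> indices
  where \<open>v\<close> has the value \<open>q\<close>. Their number is \<open>t - |v| + d\<close> choose \<open>d\<close>, a polynomial in \<open>t\<close> of degree
  \<open>d\<close> with positive leading coefficient, valid once \<open>t \<ge> |v|\<close>; and \<open>|v| \<le> l q\<close>. Summing over the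
  irreducible shapes gives \<open>h\<close> and its degree (\<open>counting_polynomial\<close>).

  Division needs an argument because the variables do not commute: \<open>D\<^sub>i S\<^sub>j\<close> is \<open>S\<^sub>j\<close> times a linear form
  in all the \<open>D\<close>'s, so \<open>X\<^sup>\<gamma> X\<^sup>\<beta>\<close> need not have \<open>X\<^bsup>\<gamma>+\<beta>\<^esup>\<close> as its leading monomial. Yet the \<open>\<sigma>\<^sub>j\<close> are bijective on
  the subalgebra generated by \<open>R\<close> and the \<open>D\<close>'s, so every element of it that stands to the right of a
  power of the \<open>S\<close>'s can be moved to the left of it. This produces, for \<open>\<beta> \<le> \<alpha>\<close>, a multiplier that
  takes \<open>r X\<^sup>\<beta>\<close>, for any nonzero scalar \<open>r\<close>, to a nonzero multiple of \<open>X\<^sup>\<alpha>\<close> plus terms of smaller degree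
  (\<open>raise_monomial\<close>). The lower terms of an element of \<open>A\<^sup>p\<close> are controlled by the compatibility of
  the ordering with multiplication (\<open>LM_multiple\<close>).

  For the second part, the space \<open>V\<close> of elements of degree at most \<open>1\<close> satisfies \<open>V\<^sup>t E = M\<^sub>0 + \<dots> + M\<^sub>t\<close> for
  \<open>t > 0\<close>, whereas arbitrary \<open>V\<close> and \<open>F\<close> have bounded degrees, so that \<open>dim (V\<^sup>t F) \<le> HF\<^sub>M(s t + c)\<close> for
  suitable \<open>s\<close> and \<open>c\<close>. Both bounds grow like \<open>t\<close> to the power \<open>deg h\<close> (\<open>elog_growth\<close>, \<open>GKdim_eq\<close>).
\<close>

section \<open>Dimensions of linear images\<close>

context vector_space
begin

text \<open>
  The module \<open>A\<^sup>p / N\<close> is a record with a carrier, while \<open>A\<^sup>p\<close> is a type. This lemma and the next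
  transfer spans and dimensions along the map \<open>f \<mapsto> f + N\<close>, so that all linear algebra can be done in
  the type. The linearity of \<open>\<phi>\<close> is demanded on a subspace only, because the second lemma takes as
  target the record with a smaller carrier.
\<close>

lemma module_span_image:
  assumes Q: "Module.module (scalar_ring :: 'a ring) Q"
    and U: "subspace U"
    and add: "\<And>x y. x \<in> U \<Longrightarrow> y \<in> U \<Longrightarrow> \<phi> (x + y) = add Q (\<phi> x) (\<phi> y)"
    and smult: "\<And>c x. x \<in> U \<Longrightarrow> \<phi> (scale c x) = Module.smult Q c (\<phi> x)"
    and im: "\<phi> ` U \<subseteq> carrier Q" and Y: "Y \<subseteq> U"
  shows "LinearCombinations.module.span scalar_ring Q (\<phi> ` Y) = \<phi> ` span Y"
proof -
  interpret Q: Module.module "scalar_ring :: 'a ring" Q by (rule Q)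
  have U0: "0 \<in> U" using U by (rule subspace_0)
  have zero: "\<phi> 0 = \<zero>\<^bsub>Q\<^esub>"
    using smult[of 0 0] U0 im Q.smult_l_null[of "\<phi> 0"] by auto
  have sp: "span Y \<subseteq> U" using Y U by (rule span_minimal)
  have YQ: "\<phi> ` Y \<subseteq> carrier Q" using Y im by auto
  have sub: "LinearCombinations.submodule scalar_ring (LinearCombinations.module.span scalar_ring Q (\<phi> ` Y)) Q"
    by (rule Q.span_is_submodule[OF YQ])
  have own: "\<phi> ` Y \<subseteq> LinearCombinations.module.span scalar_ring Q (\<phi> ` Y)"
    by (rule Q.in_own_span[OF YQ])
  show ?thesis
  proof
    have "LinearCombinations.submodule scalar_ring (\<phi> ` span Y) Q"
      unfolding LinearCombinations.submodule_def
    proof (intro conjI allI impI)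
      show "\<phi> ` span Y \<subseteq> carrier Q" using sp im by auto
    next
      fix v w assume "v \<in> \<phi> ` span Y" "w \<in> \<phi> ` span Y"
      then obtain a b where ab: "a \<in> span Y" "b \<in> span Y" "v = \<phi> a" "w = \<phi> b" by auto
      then have "add Q v w = \<phi> (a + b)" using sp by (subst add) auto
      then show "add Q v w \<in> \<phi> ` span Y" using ab by (auto intro: span_add)
    next
      show "\<zero>\<^bsub>Q\<^esub> \<in> \<phi> ` span Y" using zero span_zero by (metis imageI)
    next
      fix c v assume "v \<in> \<phi> ` span Y"
      then obtain a where a: "a \<in> span Y" "v = \<phi> a" by auto
      then have "Module.smult Q c v = \<phi> (scale c a)" using sp by (subst smult) auto
      then show "Module.smult Q c v \<in> \<phi> ` span Y" using a by (auto intro: span_scale)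
    qed (rule Q)
    then show "LinearCombinations.module.span scalar_ring Q (\<phi> ` Y) \<subseteq> \<phi> ` span Y"
      by (intro Q.span_is_subset image_mono span_superset)
  next
    have "span Y \<subseteq> {f \<in> U. \<phi> f \<in> LinearCombinations.module.span scalar_ring Q (\<phi> ` Y)}"
    proof (rule span_minimal)
      show "Y \<subseteq> {f \<in> U. \<phi> f \<in> LinearCombinations.module.span scalar_ring Q (\<phi> ` Y)}"
        using Y own by auto
      show "subspace {f \<in> U. \<phi> f \<in> LinearCombinations.module.span scalar_ring Q (\<phi> ` Y)}"
        using sub U unfolding LinearCombinations.submodule_def subspace_def
        by (auto simp: add smult zero)
    qed
    then show "\<phi> ` span Y \<subseteq> LinearCombinations.module.span scalar_ring Q (\<phi> ` Y)" by auto
  qed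
qed

text \<open>
  The dimension of a record is the least size of a generating set. Generating sets of the image are
  images of generating sets in \<open>span B\<close> as \<open>\<phi>\<close> is injective there, and those have at least
  \<open>card B\<close> elements because \<open>B\<close> is independent.
\<close>

lemma vectorspace_dim_image:
  assumes Q: "vectorspace (scalar_ring :: 'a ring) Q"
    and add: "\<And>x y. x \<in> span B \<Longrightarrow> y \<in> span B \<Longrightarrow> \<phi> (x + y) = add Q (\<phi> x) (\<phi> y)"
    and smult: "\<And>c x. x \<in> span B \<Longrightarrow> \<phi> (scale c x) = Module.smult Q c (\<phi> x)"
    and im: "\<phi> ` span B = carrier Q" and inj: "inj_on \<phi> (span B)"
    and B: "finite B" "independent B"
  shows "vectorspace.dim scalar_ring Q = card B"
proof -
  have mod: "Module.module (scalar_ring :: 'a ring) Q"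
    using Q by (simp add: vectorspace_def)
  have sp: "LinearCombinations.module.span scalar_ring Q (\<phi> ` Y) = \<phi> ` span Y" if "Y \<subseteq> span B" for Y
    by (rule module_span_image[where U="span B"]) (use mod add smult im that in auto)
  show ?thesis
    unfolding vectorspace.dim_def[OF Q]
  proof (rule Least_equality)
    show "\<exists>A. finite A \<and> card A = card B \<and> A \<subseteq> carrier Q \<and>
        LinearCombinations.module.span scalar_ring Q A = carrier Q"
    proof (intro exI[of _ "\<phi> ` B"] conjI)
      show "card (\<phi> ` B) = card B"
        using inj span_superset by (meson card_image inj_on_subset)
      show "\<phi> ` B \<subseteq> carrier Q" using im span_superset by blast
      show "LinearCombinations.module.span scalar_ring Q (\<phi> ` B) = carrier Q"
        using sp[of B] im span_superset by auto
    qed (use B in auto)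
  next
    fix n assume "\<exists>A. finite A \<and> card A = n \<and> A \<subseteq> carrier Q \<and>
        LinearCombinations.module.span scalar_ring Q A = carrier Q"
    then obtain A where A: "finite A" "card A = n" "A \<subseteq> \<phi> ` span B"
      "LinearCombinations.module.span scalar_ring Q A = \<phi> ` span B" using im by auto
    then obtain Y where Y: "Y \<subseteq> span B" "finite Y" "card Y = n" "A = \<phi> ` Y"
      by (metis card_image finite_image_iff inj inj_on_subset subset_image_iff)
    have "\<phi> ` span Y = \<phi> ` span B" using sp[OF Y(1)] A(4) Y(4) by simp
    then have "span Y = span B"
      using inj_on_image_eq_iff[OF inj, of "span Y" "span B"] Y(1)
      by (simp add: span_minimal)
    then have "B \<subseteq> span Y" using span_superset by auto
    then show "card B \<le> n"
      using independent_span_bound[OF Y(2) B(2)] Y(3) by simp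
  qed
qed

end

section \<open>Counting monomials by shape\<close>

definition exponents_on :: "nat set \<Rightarrow> nat \<Rightarrow> (nat \<Rightarrow> nat) set" where
  "exponents_on T s = {\<alpha>. (\<forall>j. j \<notin> T \<longrightarrow> \<alpha> j = 0) \<and> sum \<alpha> T \<le> s}"

text \<open>
  Splitting off the value \<open>k\<close> at one index \<open>j\<close> leaves an exponent on the remaining indices with sum
  at most \<open>s - k\<close>; summing over \<open>k\<close> is the hockey-stick identity.
\<close>

lemma finite_card_exponents_on:
  assumes "finite T"
  shows "finite (exponents_on T s) \<and> card (exponents_on T s) = (s + card T) choose card T"
  using assms
proof (induction T arbitrary: s rule: finite_induct)
  case empty
  have "exponents_on {} s = {\<lambda>_. 0}" by (auto simp: exponents_on_def)
  then show ?case by simp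
next
  case (insert j T)
  let ?f = "\<lambda>(k, \<alpha>). \<alpha>(j := k)"
  let ?P = "SIGMA k:{..s}. exponents_on T (s - k)"
  have sum_upd: "sum (\<alpha>(j := k)) T = sum \<alpha> T" for \<alpha> k
    using insert.hyps by (intro sum.cong) auto
  have im: "exponents_on (insert j T) s = ?f ` ?P"
  proof (intro equalityI subsetI)
    fix \<alpha> assume \<alpha>: "\<alpha> \<in> exponents_on (insert j T) s"
    then have "sum \<alpha> (insert j T) \<le> s" by (simp add: exponents_on_def)
    then have "\<alpha> j + sum \<alpha> T \<le> s" using insert.hyps by simp
    then have "sum (\<alpha>(j := 0)) T \<le> s - \<alpha> j" "\<alpha> j \<le> s"
      by (simp_all only: sum_upd)
    moreover have "(\<alpha>(j := 0)) i = 0" if "i \<notin> T" for i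
      using \<alpha> that by (auto simp: exponents_on_def)
    ultimately have "(\<alpha> j, \<alpha>(j := 0)) \<in> ?P"
      by (simp add: exponents_on_def del: fun_upd_apply)
    moreover have "?f (\<alpha> j, \<alpha>(j := 0)) = \<alpha>" by simp
    ultimately show "\<alpha> \<in> ?f ` ?P" by (metis imageI)
  next
    fix \<beta> assume "\<beta> \<in> ?f ` ?P"
    then obtain k \<alpha> where "k \<le> s" "\<alpha> \<in> exponents_on T (s - k)" "\<beta> = \<alpha>(j := k)" by auto
    moreover from this have "sum \<beta> (insert j T) = k + sum \<alpha> T"
      using insert.hyps sum_upd[of \<alpha> k] by simp
    ultimately show "\<beta> \<in> exponents_on (insert j T) s"
      by (auto simp: exponents_on_def)
  qed
  have inj: "inj_on ?f ?P"
  proof (rule inj_onI, clarify, intro conjI)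
    fix k \<alpha> k' \<alpha>'
    assume \<alpha>: "\<alpha> \<in> exponents_on T (s - k)" "\<alpha>' \<in> exponents_on T (s - k')"
      and eq: "\<alpha>(j := k) = \<alpha>'(j := k')"
    show "k = k'" using eq by (metis fun_upd_same)
    show "\<alpha> = \<alpha>'"
    proof
      fix i
      show "\<alpha> i = \<alpha>' i"
        using \<alpha> insert.hyps fun_cong[OF eq, of i]
        by (cases "i = j") (auto simp: exponents_on_def)
    qed
  qed
  have "card (exponents_on (insert j T) s) = card ?P"
    unfolding im by (rule card_image[OF inj])
  also have "\<dots> = (\<Sum>k\<le>s. (s - k + card T) choose card T)"
    using insert.IH by (subst card_SigmaI) auto
  also have "\<dots> = (\<Sum>k\<le>s. (card T + k) choose card T)"
    by (rule sum.reindex_bij_witness[of _ "\<lambda>k. s - k" "\<lambda>k. s - k"]) (auto simp: add.commute)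
  also have "\<dots> = (s + card (insert j T)) choose card (insert j T)"
    using insert.hyps by (subst choose_rising_sum(1)) (simp add: add.commute del: binomial_Suc_Suc)
  finally have "card (exponents_on (insert j T) s) = \<dots>" .
  moreover have "finite (exponents_on (insert j T) s)"
    unfolding im using insert.IH by auto
  ultimately show ?case by simp
qed

text \<open>
  The polynomial function \<open>t \<mapsto> (t - a + d) choose d\<close>, where \<open>t - a\<close> is the subtraction of rationals; it
  is the number of exponents on \<open>d\<close> indices with sum at most \<open>t - a\<close> as soon as \<open>t \<ge> a\<close>.
\<close>

definition binomial_poly :: "nat \<Rightarrow> nat \<Rightarrow> rat poly" where
  "binomial_poly a d = Polynomial.smult (1 / fact d) (\<Prod>i=1..d. [:of_nat i - of_nat a, 1:])"

lemma poly_binomial_poly: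
  assumes "a \<le> t"
  shows "poly (binomial_poly a d) (of_nat t) = of_nat ((t - a + d) choose d)"
proof -
  have "of_nat ((t - a + d) choose d) = (of_nat (t - a + d) gchoose d :: rat)"
    by (simp add: binomial_gbinomial)
  also have "\<dots> = (\<Prod>i<d. of_nat (t - a + d) - of_nat i) / fact d"
    by (simp add: gbinomial_prod_rev atLeast0LessThan)
  also have "(\<Prod>i<d. of_nat (t - a + d) - of_nat i :: rat) = (\<Prod>i=1..d. of_nat t + (of_nat i - of_nat a))"
    by (rule prod.reindex_bij_witness[of _ "\<lambda>i. d - i" "\<lambda>i. d - i"])
      (use assms in \<open>auto simp: of_nat_diff\<close>)
  finally show ?thesis
    by (simp add: binomial_poly_def poly_prod algebra_simps)
qed

lemma degree_binomial_poly: "degree (binomial_poly a d) = d"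
  and lead_coeff_binomial_poly: "lead_coeff (binomial_poly a d) > 0"
proof -
  have 1: "degree (\<Prod>i=1..d. [:of_nat i - of_nat a, 1::rat:]) = d"
    by (subst degree_prod_eq_sum_degree) auto
  have 2: "lead_coeff (\<Prod>i=1..d. [:of_nat i - of_nat a, 1::rat:]) = 1"
    by (subst lead_coeff_prod) auto
  show "degree (binomial_poly a d) = d"
    using 1 by (simp add: binomial_poly_def)
  show "lead_coeff (binomial_poly a d) > 0"
    using 2 by (simp only: binomial_poly_def lead_coeff_smult) simp
qed

lemma add_poly_positive_lead_coeff:
  fixes p q :: "'b::linordered_idom poly"
  assumes "lead_coeff p > 0" "lead_coeff q > 0"
  shows "degree (p + q) = max (degree p) (degree q) \<and> lead_coeff (p + q) > 0"
proof (cases "degree p" "degree q" rule: linorder_cases)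
  case less
  then show ?thesis using assms by (simp add: degree_add_eq_right coeff_eq_0)
next
  case greater
  then show ?thesis using assms
    by (simp add: degree_add_eq_left coeff_eq_0)
next
  case equal
  then have c: "coeff (p + q) (degree p) > 0" using assms by simp
  then have "degree p \<le> degree (p + q)" by (intro le_degree) (metis less_irrefl)
  moreover have "degree (p + q) \<le> degree p" using equal by (intro degree_add_le) auto
  moreover note c
  ultimately show ?thesis using equal by simp
qed

text \<open>
  Leading terms with positive coefficients cannot cancel, hence the degree of a sum is the maximum of
  the degrees.
\<close>

lemma degree_sum_positive_lead_coeff:
  fixes p :: "'c \<Rightarrow> 'b::linordered_idom poly"
  assumes "finite I" "I \<noteq> {}" "\<And>i. i \<in> I \<Longrightarrow> lead_coeff (p i) > 0"
  shows "degree (\<Sum>i\<in>I. p i) = Max ((\<lambda>i. degree (p i)) ` I) \<and> lead_coeff (\<Sum>i\<in>I. p i) > 0"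
  using assms
proof (induction rule: finite_ne_induct)
  case (insert i I)
  then have "degree (sum p I) = Max ((\<lambda>i. degree (p i)) ` I)" "lead_coeff (sum p I) > 0"
    "lead_coeff (p i) > 0" by auto
  note IH = this
  have M: "Max ((\<lambda>i. degree (p i)) ` insert i I) = max (degree (p i)) (degree (sum p I))"
    using insert.hyps IH(1) by simp
  have s: "sum p (insert i I) = p i + sum p I"
    using insert.hyps by simp
  show ?case
    unfolding M s by (rule add_poly_positive_lead_coeff[OF IH(3,2)])
qed simp


text \<open>
  This bound explains the threshold \<open>l * q\<close>: for \<open>t\<close> from there on, no shape is excluded by the degree
  bound \<open>t\<close>, and the natural number \<open>t - tdeg l v\<close> is a true difference for every shape \<open>v\<close>.
\<close>

lemma tdeg_shape_le: "tdeg l (shape q u) \<le> l * q"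
  using sum_bounded_above[of "{1..l}" "\<lambda>j. min q (fst u j)" q]
  by (simp add: tdeg_def shape_def)

lemma top_indices_subset: "top_indices l q u \<subseteq> {1..l}"
  by (auto simp: top_indices_def)

lemma finite_monomials_bounded: "finite {u \<in> (monomials l :: 'p::finite monom set). tdeg l u \<le> t}"
proof (rule finite_subset)
  show "{u \<in> monomials l. tdeg l u \<le> t} \<subseteq> exponents_on {1..l} t \<times> (UNIV :: 'p set)"
    by (auto simp: monomials_def exps_def exponents_on_def tdeg_def)
  show "finite (exponents_on {1..l} t \<times> (UNIV :: 'p set))"
    using finite_card_exponents_on[of "{1..l}"] by simp
qed

lemma finite_shapes: "finite {v \<in> (monomials l :: 'p::finite monom set). shape q v = v}"
  using finite_monomials_bounded[of l "l * q"]
  by (rule rev_finite_subset) (metis (mono_tags, lifting) Collect_mono tdeg_shape_le)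

text \<open>
  An exponent of shape \<open>v\<close> coincides with \<open>v\<close> at the indices outside \<open>top_indices l q v\<close> and is at
  least \<open>q\<close> at the others, where it can be chosen freely: subtracting \<open>v\<close> is a bijection onto the
  exponents supported on \<open>top_indices l q v\<close>.
\<close>

lemma card_shape_class:
  fixes v :: "'p::finite monom"
  assumes v: "v \<in> monomials l" "shape q v = v" and t: "l * q \<le> t"
  shows "card {u \<in> monomials l. shape q u = v \<and> tdeg l u \<le> t} =
    (t - tdeg l v + card (top_indices l q v)) choose card (top_indices l q v)"
proof -
  let ?T = "top_indices l q v"
  let ?f = "\<lambda>\<alpha> :: nat \<Rightarrow> nat. (\<lambda>j. \<alpha> j + fst v j, snd v)"
  have vt: "tdeg l v \<le> t" using tdeg_shape_le[of l q v] v t by simp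
  have vq: "fst v j \<le> q" for j
    using v(2) by (metis fst_conv min.cobounded1 shape_def)
  have vT: "fst v j = q" if "j \<in> ?T" for j
    using vq[of j] that by (simp add: top_indices_def)
  have v0: "fst v j = 0" if "j \<notin> {1..l}" for j
    using v(1) that by (auto simp: monomials_def exps_def)
  have sums: "sum \<alpha> {1..l} = sum \<alpha> ?T" if "\<forall>j. j \<notin> ?T \<longrightarrow> \<alpha> j = 0" for \<alpha> :: "nat \<Rightarrow> nat"
    using that top_indices_subset[of l q v] by (intro sum.mono_neutral_right) auto
  have "{u \<in> monomials l. shape q u = v \<and> tdeg l u \<le> t} = ?f ` exponents_on ?T (t - tdeg l v)"
  proof (intro equalityI subsetI)
    fix u assume u: "u \<in> {u \<in> monomials l. shape q u = v \<and> tdeg l u \<le> t}"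
    define \<alpha> where "\<alpha> = (\<lambda>j. fst u j - fst v j)"
    have uv: "min q (fst u j) = fst v j" for j
      using u by (auto simp: shape_def)
    have le: "fst v j \<le> fst u j" for j using uv[of j] by simp
    have 0: "\<alpha> j = 0" if "j \<notin> ?T" for j
    proof (cases "j \<in> {1..l}")
      case True
      then show ?thesis using that uv[of j] by (auto simp: top_indices_def \<alpha>_def)
    next
      case False
      then show ?thesis using u by (auto simp: \<alpha>_def monomials_def exps_def)
    qed
    have "sum \<alpha> {1..l} + tdeg l v = tdeg l u"
      unfolding tdeg_def \<alpha>_def sum.distrib[symmetric] using le by (intro sum.cong) auto
    then have "\<alpha> \<in> exponents_on ?T (t - tdeg l v)"
      using 0 sums[of \<alpha>] u by (auto simp: exponents_on_def)
    moreover have "snd u = snd v"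
      using u by (auto simp: shape_def)
    then have "u = ?f \<alpha>" using le by (auto simp: \<alpha>_def prod_eq_iff)
    ultimately show "u \<in> ?f ` exponents_on ?T (t - tdeg l v)" by blast
  next
    fix u assume "u \<in> ?f ` exponents_on ?T (t - tdeg l v)"
    then obtain \<alpha> where \<alpha>: "\<alpha> \<in> exponents_on ?T (t - tdeg l v)" and u: "u = ?f \<alpha>" by auto
    have 0: "\<alpha> j = 0" if "j \<notin> ?T" for j using \<alpha> that by (simp add: exponents_on_def)
    have "tdeg l u = sum \<alpha> {1..l} + tdeg l v"
      by (simp add: u tdeg_def sum.distrib)
    then have "tdeg l u \<le> t"
      using \<alpha> sums[of \<alpha>] vt by (auto simp: exponents_on_def)
    moreover have "min q (\<alpha> j + fst v j) = fst v j" for j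
      using 0[of j] vT[of j] vq[of j] by (cases "j \<in> ?T") auto
    then have "shape q u = v" by (simp add: u shape_def)
    moreover have "\<alpha> j = 0" if "j \<notin> {1..l}" for j
      using 0 that top_indices_subset[of l q v] by blast
    then have "u \<in> monomials l"
      using v0 by (simp add: u monomials_def exps_def)
    ultimately show "u \<in> {u \<in> monomials l. shape q u = v \<and> tdeg l u \<le> t}" by simp
  qed
  moreover have "inj_on ?f (exponents_on ?T (t - tdeg l v))"
    by (rule inj_onI) (simp add: fun_eq_iff)
  ultimately show ?thesis
    using finite_card_exponents_on[of ?T "t - tdeg l v"] finite_subset[OF top_indices_subset[of l q v]]
    by (simp add: card_image)
qed

text \<open>
  A set of monomials that is determined by shapes is a disjoint union of finitely many shape classes,
  each of which contributes a binomial polynomial. The factor \<open>d\<close> is later the degree of the field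
  extension.
\<close>

lemma counting_polynomial:
  fixes I :: "'p::finite monom set"
  assumes I: "I \<subseteq> monomials l" and d: "d > (0::nat)"
    and shape: "\<And>u. u \<in> monomials l \<Longrightarrow> u \<in> I \<longleftrightarrow> shape q u \<in> I"
  obtains h :: "rat poly" where
    "\<And>t. l * q \<le> t \<Longrightarrow> of_nat (d * card {u \<in> I. tdeg l u \<le> t}) = poly h (of_nat t)"
    "h \<noteq> 0 \<Longrightarrow> lead_coeff h > 0"
    "edegree h = emax {card (top_indices l q u) | u. u \<in> I \<and> shape q u = u}"
proof -
  define V where "V = {v \<in> I. shape q v = v}"
  define p where "p v = Polynomial.smult (of_nat d)
    (binomial_poly (tdeg l v) (card (top_indices l q v)))" for v :: "'p monom"
  have fin: "finite V"
    using finite_shapes[of l q] by (rule rev_finite_subset) (use I in \<open>auto simp: V_def\<close>)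
  have deg: "degree (p v) = card (top_indices l q v)" and pos: "lead_coeff (p v) > 0" for v
    using d degree_binomial_poly lead_coeff_binomial_poly
    by (simp_all only: p_def degree_smult_eq lead_coeff_smult) auto
  \<comment> \<open>Shapes are idempotent, so they index the shape classes that make up \<open>I\<close>.\<close>
  have sh: "shape q u \<in> V" if "u \<in> I" for u
    using that I shape[of u] by (auto simp: V_def shape_def)
  have "of_nat (d * card {u \<in> I. tdeg l u \<le> t}) = poly (sum p V) (of_nat t)"
    if t: "l * q \<le> t" for t
  proof -
    have "{u \<in> I. tdeg l u \<le> t} = (\<Union>v\<in>V. {u \<in> monomials l. shape q u = v \<and> tdeg l u \<le> t})"
      using I sh shape by (auto simp: V_def)
    moreover have "finite {u \<in> monomials l. shape q u = v \<and> tdeg l u \<le> t}" for v :: "'p monom"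
      using finite_monomials_bounded[of l t] by (rule rev_finite_subset) auto
    ultimately have "card {u \<in> I. tdeg l u \<le> t} =
        (\<Sum>v\<in>V. card {u \<in> monomials l. shape q u = v \<and> tdeg l u \<le> t})"
      using fin by (simp only:) (rule card_UN_disjoint, auto)
    also have "\<dots> = (\<Sum>v\<in>V. (t - tdeg l v + card (top_indices l q v)) choose card (top_indices l q v))"
      using I t by (intro sum.cong card_shape_class) (auto simp: V_def)
    also have "of_nat (d * \<dots>) = poly (sum p V) (of_nat t)"
    proof -
      have "tdeg l v \<le> t" if "v \<in> V" for v
        using that t tdeg_shape_le[of l q v] by (simp add: V_def)
      then show ?thesis
        by (simp add: poly_sum p_def poly_binomial_poly sum_distrib_left)
    qed
    finally show ?thesis .
  qed
  moreover have "{card (top_indices l q u) | u. u \<in> I \<and> shape q u = u} = (\<lambda>v. degree (p v)) ` V"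
    by (auto simp: V_def deg)
  moreover have "edegree (sum p V) = emax ((\<lambda>v. degree (p v)) ` V)"
    "sum p V \<noteq> 0 \<Longrightarrow> lead_coeff (sum p V) > 0"
    using degree_sum_positive_lead_coeff[of V p, OF fin _ pos]
    by (cases "V = {}"; force simp: edegree_def emax_def)+
  ultimately show ?thesis using that[of "sum p V"] by simp
qed

section \<open>Growth of polynomial functions\<close>

lemma tendsto_rescaled_polynomial:
  fixes h :: "rat poly" and H :: "nat \<Rightarrow> nat"
  assumes H: "\<And>t. t \<ge> t0 \<Longrightarrow> of_nat (H t) = poly h (of_nat t)" and c: "c > 0"
  shows "(\<lambda>n. real (H (c * n + d)) / real n ^ degree h) \<longlonglongrightarrow> of_rat (lead_coeff h) * real c ^ degree h"
proof -
  let ?D = "degree h"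
  have val: "real (H t) = (\<Sum>i\<le>?D. of_rat (coeff h i) * real t ^ i)" if "t \<ge> t0" for t
  proof -
    have "real (H t) = of_rat (of_nat (H t))" by simp
    also have "\<dots> = of_rat (\<Sum>i\<le>?D. coeff h i * of_nat t ^ i)"
      by (simp only: H[OF that] poly_altdef)
    finally show ?thesis by (simp add: of_rat_sum of_rat_mult of_rat_power)
  qed
  have "(\<lambda>n. of_rat (coeff h i) * ((real c + real d / real n) ^ i * (1 / real n) ^ (?D - i)))
      \<longlonglongrightarrow> of_rat (coeff h i) * ((real c + 0) ^ i * 0 ^ (?D - i))" for i
    by (intro tendsto_intros lim_const_over_n)
  then have "(\<lambda>n. \<Sum>i\<le>?D. of_rat (coeff h i) * ((real c + real d / real n) ^ i * (1 / real n) ^ (?D - i)))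
      \<longlonglongrightarrow> (\<Sum>i\<le>?D. of_rat (coeff h i) * ((real c + 0) ^ i * 0 ^ (?D - i)))"
    by (intro tendsto_sum)
  also have "(\<Sum>i\<le>?D. of_rat (coeff h i) * ((real c + 0) ^ i * 0 ^ (?D - i))) =
      (\<Sum>i\<in>{?D}. of_rat (coeff h i) * ((real c + 0) ^ i * 0 ^ (?D - i)))"
    by (rule sum.mono_neutral_right) auto
  also have "\<dots> = of_rat (lead_coeff h) * real c ^ ?D" by simp
  finally show ?thesis
  proof (rule Lim_transform_eventually)
    show "\<forall>\<^sub>F n in sequentially.
        (\<Sum>i\<le>?D. of_rat (coeff h i) * ((real c + real d / real n) ^ i * (1 / real n) ^ (?D - i))) =
        real (H (c * n + d)) / real n ^ ?D"
      using eventually_ge_at_top[of "max 1 t0"]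
    proof eventually_elim
      case (elim n)
      have "n \<le> c * n + d" using c by (metis le_add1 le_trans mult_le_mono1 nat_mult_1 Suc_leI One_nat_def)
      then have n: "n > 0" "c * n + d \<ge> t0" using elim by linarith+
      have "of_rat (coeff h i) * ((real c + real d / real n) ^ i * (1 / real n) ^ (?D - i)) =
          of_rat (coeff h i) * real (c * n + d) ^ i / real n ^ ?D" if "i \<le> ?D" for i
      proof -
        have "real n ^ ?D = real n ^ i * real n ^ (?D - i)"
          using that by (simp flip: power_add)
        moreover have "real c + real d / real n = real (c * n + d) / real n"
          using n by (simp add: field_simps)
        ultimately show ?thesis by (simp add: power_divide)
      qed
      then show ?case
        by (simp add: val[OF n(2)] sum_divide_distrib)
    qed
  qed
qed

text \<open>
  An affine change of variable does not affect the exponent of growth. Hence bounds on dimensions by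
  values of the Hilbert function at \<open>n\<close> and at \<open>c n + d\<close> determine the same exponent.
\<close>

lemma elog_growth:
  fixes h :: "rat poly" and H :: "nat \<Rightarrow> nat"
  assumes H: "\<And>t. t \<ge> t0 \<Longrightarrow> of_nat (H t) = poly h (of_nat t)" and c: "c > 0"
    and pos: "h \<noteq> 0 \<Longrightarrow> lead_coeff h > 0"
  shows "(\<lambda>n. elog n (H (c * n + d))) \<longlonglongrightarrow> edegree h"
proof (cases "h = 0")
  case True
  have "\<forall>\<^sub>F n in sequentially. -\<infinity> = elog n (H (c * n + d))"
    using eventually_ge_at_top[of t0]
  proof eventually_elim
    case (elim n)
    have "n \<le> c * n + d" using c by (metis le_add1 le_trans mult_le_mono1 nat_mult_1 Suc_leI One_nat_def)
    then have "c * n + d \<ge> t0" using elim by linarith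
    from H[OF this] show ?case using True by (simp add: elog_def)
  qed
  then show ?thesis using True
    by (simp add: edegree_def) (rule Lim_transform_eventually[OF tendsto_const])
next
  case False
  let ?D = "degree h"
  define L where "L = of_rat (lead_coeff h) * real c ^ ?D"
  define y where "y n = real (H (c * n + d)) / real n ^ ?D" for n
  have L: "L > 0" using pos[OF False] c by (simp add: L_def)
  have y: "y \<longlonglongrightarrow> L"
    unfolding L_def y_def by (rule tendsto_rescaled_polynomial[OF H c])
  have "(\<lambda>n. inverse (ln (real n))) \<longlonglongrightarrow> 0"
    by (rule tendsto_inverse_0_at_top[OF filterlim_compose[OF ln_at_top filterlim_real_sequentially]])
  then have "(\<lambda>n. real ?D + ln (y n) * inverse (ln (real n))) \<longlonglongrightarrow> real ?D + ln L * 0"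
    using L by (intro tendsto_intros y) auto
  then have "(\<lambda>n. ereal (real ?D + ln (y n) * inverse (ln (real n)))) \<longlonglongrightarrow> edegree h"
    using False by (simp add: edegree_def)
  moreover have "\<forall>\<^sub>F n in sequentially. ereal (real ?D + ln (y n) * inverse (ln (real n))) = elog n (H (c * n + d))"
    using eventually_ge_at_top[of 2] order_tendstoD(1)[OF y L]
  proof eventually_elim
    case (elim n)
    then have H: "real (H (c * n + d)) > 0" by (simp add: y_def zero_less_divide_iff)
    have n: "real n > 0" "ln (real n) > 0" using elim by auto
    have "real (H (c * n + d)) = y n * real n ^ ?D" using n by (simp add: y_def)
    then have "ln (real (H (c * n + d))) = ln (y n) + real ?D * ln (real n)"
      using elim n by (simp add: ln_mult ln_realpow)
    then have "log (real n) (real (H (c * n + d))) = real ?D + ln (y n) * inverse (ln (real n))"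
      using n by (simp add: log_def field_simps)
    then show ?case using H by (simp add: elog_def)
  qed
  ultimately show ?thesis by (rule Lim_transform_eventually)
qed

lemma elog_mono: "a \<le> b \<Longrightarrow> n \<ge> 2 \<Longrightarrow> elog n a \<le> elog n b"
  by (auto simp: elog_def)

section \<open>Products of words\<close>

text \<open>
  Writing a monomial as a product of single generators, instead of powers, lets inductions add one
  generator at a time.
\<close>

definition letters :: "(nat \<Rightarrow> nat) \<Rightarrow> nat list \<Rightarrow> nat list" where
  "letters \<alpha> js = concat (map (\<lambda>j. replicate (\<alpha> j) j) js)"

lemma prod_list_letters:
  fixes x :: "nat \<Rightarrow> 'a::monoid_mult"
  shows "prod_list (map (\<lambda>j. x j ^ \<alpha> j) js) = prod_list (map x (letters \<alpha> js))"
  by (induction js) (simp_all add: letters_def prod_list_replicate)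

lemma length_letters: "length (letters \<alpha> js) = sum_list (map \<alpha> js)"
  by (induction js) (simp_all add: letters_def)

lemma set_letters: "set (letters \<alpha> js) \<subseteq> set js"
  by (auto simp: letters_def)

lemma commute_prod_list:
  fixes a :: "'a::monoid_mult"
  assumes "\<And>y. y \<in> set ys \<Longrightarrow> a * y = y * a"
  shows "a * prod_list ys = prod_list ys * a"
  using assms
proof (induction ys)
  case (Cons y ys)
  have "a * (y * prod_list ys) = y * (a * prod_list ys)"
    using Cons.prems[of y] by (simp flip: mult.assoc)
  then show ?case using Cons by (simp add: mult.assoc)
qed simp

lemma prod_list_power_add:
  fixes x :: "nat \<Rightarrow> 'a::monoid_mult"
  assumes "\<And>i j. i \<in> set js \<Longrightarrow> j \<in> set js \<Longrightarrow> x i * x j = x j * x i"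
  shows "prod_list (map (\<lambda>j. x j ^ (\<alpha> j + \<beta> j)) js) =
    prod_list (map (\<lambda>j. x j ^ \<alpha> j) js) * prod_list (map (\<lambda>j. x j ^ \<beta> j) js)"
  using assms
proof (induction js)
  case (Cons k js)
  let ?p = "prod_list (map (\<lambda>j. x j ^ \<alpha> j) js)" and ?q = "prod_list (map (\<lambda>j. x j ^ \<beta> j) js)"
  have "x k * ?p = ?p * x k"
    using Cons.prems by (intro commute_prod_list) (auto intro!: power_commuting_commutes[symmetric])
  then have "x k ^ \<beta> k * ?p = ?p * x k ^ \<beta> k"
    by (rule power_commuting_commutes)
  then have "x k ^ \<alpha> k * x k ^ \<beta> k * (?p * ?q) = x k ^ \<alpha> k * ?p * (x k ^ \<beta> k * ?q)"
    by (simp add: mult.assoc) (simp flip: mult.assoc)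
  then show ?case using Cons by (simp add: power_add)
qed simp

text \<open>
  If elements of a set \<open>C\<close> can be moved across each letter, changing only within \<open>C\<close>, then they can
  be moved across the whole product. In the uses of this rule and of its mirror image below, \<open>C\<close> is
  \<open>R - {0}\<close>, the set of linear forms in the \<open>D\<close>'s, or the subalgebra generated by \<open>R\<close> and the \<open>D\<close>'s.
\<close>

lemma push_prod_list:
  fixes c :: "'a::monoid_mult"
  assumes "\<And>c y. c \<in> C \<Longrightarrow> y \<in> set ys \<Longrightarrow> \<exists>c'\<in>C. c * y = y * c'" and "c \<in> C"
  shows "\<exists>c'\<in>C. c * prod_list ys = prod_list ys * c'"
  using assms
proof (induction ys arbitrary: c)
  case (Cons y ys)
  obtain c1 where 1: "c1 \<in> C" "c * y = y * c1" using Cons.prems by auto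
  obtain c2 where 2: "c2 \<in> C" "c1 * prod_list ys = prod_list ys * c2"
    using Cons.IH[OF _ 1(1)] Cons.prems by auto
  have "c * prod_list (y # ys) = prod_list (y # ys) * c2"
    using 1 2 by (simp add: mult.assoc[symmetric]) (simp add: mult.assoc)
  then show ?case using 2 by blast
qed auto

lemma pull_prod_list:
  fixes c :: "'a::monoid_mult"
  assumes "\<And>c y. c \<in> C \<Longrightarrow> y \<in> set ys \<Longrightarrow> \<exists>c'\<in>C. y * c = c' * y" and "c \<in> C"
  shows "\<exists>c'\<in>C. prod_list ys * c = c' * prod_list ys"
  using assms
proof (induction ys arbitrary: c)
  case (Cons y ys)
  obtain c1 where 1: "c1 \<in> C" "prod_list ys * c = c1 * prod_list ys"
    using Cons.IH[OF _ Cons.prems(2)] Cons.prems by auto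
  obtain c2 where 2: "c2 \<in> C" "y * c1 = c2 * y" using Cons.prems 1 by auto
  have "prod_list (y # ys) * c = c2 * prod_list (y # ys)"
    using 1 2 by (simp add: mult.assoc) (simp add: mult.assoc[symmetric])
  then show ?case using 2 by blast
qed auto

section \<open>Coefficients and the total degree filtration\<close>

locale dd_field_algebra = dd_algebra scale R m n S D \<sigma> \<delta>
  for scale :: "'k::field \<Rightarrow> 'a::ring_1 \<Rightarrow> 'a" and R m n S D \<sigma> \<delta> +
  assumes field_extension: "finite_field_extension R"
begin

abbreviation "gens \<equiv> dd_gens m S D"
abbreviation "nvars \<equiv> m + n"
abbreviation "X \<equiv> xpow nvars gens"
abbreviation "cf \<equiv> coeffs_of R nvars gens"

definition weight :: "(nat \<Rightarrow> nat) \<Rightarrow> nat" where "weight \<alpha> = sum \<alpha> {1..nvars}"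

lemma R_0 [simp]: "0 \<in> R" and R_1 [simp]: "1 \<in> R"
  and R_add: "a \<in> R \<Longrightarrow> b \<in> R \<Longrightarrow> a + b \<in> R"
  and R_mult: "a \<in> R \<Longrightarrow> b \<in> R \<Longrightarrow> a * b \<in> R"
  and R_scale: "a \<in> R \<Longrightarrow> scale c a \<in> R"
  using R_subalgebra by (auto simp: subalgebra_def subspace_def)

lemma R_inverse: "a \<in> R \<Longrightarrow> a \<noteq> 0 \<Longrightarrow> \<exists>b\<in>R. a * b = 1 \<and> b * a = 1"
  using field_extension unfolding finite_field_extension_def by metis

lemma expansion_cf: "expansion R nvars gens a (cf a)"
  unfolding coeffs_of_def by (rule theI'[OF free_basis])

lemma cf_eqI: "expansion R nvars gens a c \<Longrightarrow> cf a = c"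
  using free_basis expansion_cf by blast

lemma cf_R [simp]: "cf a \<alpha> \<in> R"
  and finite_cf: "finite {\<alpha>. cf a \<alpha> \<noteq> 0}"
  and cf_exps: "cf a \<alpha> \<noteq> 0 \<Longrightarrow> \<alpha> \<in> exps nvars"
  using expansion_cf[of a] by (auto simp: expansion_def)

lemma expand:
  assumes "finite T" "{\<alpha>. cf a \<alpha> \<noteq> 0} \<subseteq> T"
  shows "a = (\<Sum>\<alpha>\<in>T. cf a \<alpha> * X \<alpha>)"
proof -
  have "a = (\<Sum>\<alpha> | cf a \<alpha> \<noteq> 0. cf a \<alpha> * X \<alpha>)"
    using expansion_cf[of a] by (simp add: expansion_def)
  also have "\<dots> = (\<Sum>\<alpha>\<in>T. cf a \<alpha> * X \<alpha>)"
    using assms by (intro sum.mono_neutral_left) auto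
  finally show ?thesis .
qed

lemma cf_sum_X:
  assumes "finite T" "T \<subseteq> exps nvars" "\<And>\<alpha>. \<alpha> \<in> T \<Longrightarrow> c \<alpha> \<in> R"
  shows "cf (\<Sum>\<alpha>\<in>T. c \<alpha> * X \<alpha>) = (\<lambda>\<alpha>. if \<alpha> \<in> T then c \<alpha> else 0)"
proof (rule cf_eqI)
  let ?c = "\<lambda>\<alpha>. if \<alpha> \<in> T then c \<alpha> else 0"
  have fin: "finite {\<alpha>. ?c \<alpha> \<noteq> 0}"
    by (rule finite_subset[OF _ assms(1)]) (auto split: if_splits)
  have "(\<Sum>\<alpha>\<in>T. c \<alpha> * X \<alpha>) = (\<Sum>\<alpha>\<in>T. ?c \<alpha> * X \<alpha>)" by (intro sum.cong) auto
  also have "\<dots> = (\<Sum>\<alpha> | ?c \<alpha> \<noteq> 0. ?c \<alpha> * X \<alpha>)"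
    using assms(1) by (intro sum.mono_neutral_right) auto
  finally show "expansion R nvars gens (\<Sum>\<alpha>\<in>T. c \<alpha> * X \<alpha>) ?c"
    using assms fin unfolding expansion_def by (auto split: if_splits)
qed

lemma cf_add: "cf (a + b) \<alpha> = cf a \<alpha> + cf b \<alpha>"
proof -
  let ?T = "{\<alpha>. cf a \<alpha> \<noteq> 0} \<union> {\<alpha>. cf b \<alpha> \<noteq> 0}"
  have fin: "finite ?T" using finite_cf by auto
  have "a + b = (\<Sum>\<alpha>\<in>?T. (cf a \<alpha> + cf b \<alpha>) * X \<alpha>)"
    using expand[OF fin, of a] expand[OF fin, of b] by (simp add: distrib_right sum.distrib)
  moreover have "cf (\<Sum>\<alpha>\<in>?T. (cf a \<alpha> + cf b \<alpha>) * X \<alpha>) = (\<lambda>\<alpha>. if \<alpha> \<in> ?T then cf a \<alpha> + cf b \<alpha> else 0)"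
    using fin cf_exps by (intro cf_sum_X) (auto intro: R_add)
  ultimately show ?thesis by simp
qed

lemma cf_mult: 
  assumes "r \<in> R"
  shows "cf (r * a) \<alpha> = r * cf a \<alpha>"
proof -
  let ?T = "{\<alpha>. cf a \<alpha> \<noteq> 0}"
  have "r * a = (\<Sum>\<alpha>\<in>?T. (r * cf a \<alpha>) * X \<alpha>)"
    by (subst expand[OF finite_cf, of a]) (auto simp: sum_distrib_left mult.assoc)
  moreover have "cf (\<Sum>\<alpha>\<in>?T. (r * cf a \<alpha>) * X \<alpha>) = (\<lambda>\<alpha>. if \<alpha> \<in> ?T then r * cf a \<alpha> else 0)"
    using finite_cf cf_exps assms by (intro cf_sum_X) (auto intro: R_mult)
  ultimately show ?thesis by simp
qed

lemma cf_X: "\<alpha> \<in> exps nvars \<Longrightarrow> cf (X \<alpha>) \<beta> = (if \<beta> = \<alpha> then 1 else 0)"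
  using cf_sum_X[of "{\<alpha>}" "\<lambda>_. 1"] by simp

lemma cf_0 [simp]: "cf 0 \<alpha> = 0"
  using cf_mult[of 0 0 \<alpha>] by simp

lemma cf_uminus: "cf (- a) \<alpha> = - cf a \<alpha>"
  using cf_add[of a "- a" \<alpha>] by (simp add: eq_neg_iff_add_eq_0 add.commute)

lemma cf_diff: "cf (a - b) \<alpha> = cf a \<alpha> - cf b \<alpha>"
  using cf_add[of a "- b" \<alpha>] by (simp add: cf_uminus)

lemma cf_scale: "cf (scale c a) \<alpha> = scale c (cf a \<alpha>)"
  using cf_mult[of "scale c 1" a \<alpha>] by (simp add: R_scale flip: scale_mult_left)

lemma cf_sum: "cf (sum f T) \<alpha> = (\<Sum>i\<in>T. cf (f i) \<alpha>)"
  by (induction T rule: infinite_finite_induct) (simp_all add: cf_add)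

lemma cf_eq_0_iff: "(\<forall>\<alpha>. cf a \<alpha> = 0) \<longleftrightarrow> a = 0"
  using expand[of "{}" a] by auto

text \<open>
  The filtration of \<open>A\<close> by total degree, with a strict bound. The strict bound allows \<open>below 0\<close>, which
  is zero, so that error terms of a monomial of degree \<open>0\<close> need no separate treatment.
\<close>

definition below :: "nat \<Rightarrow> 'a set" where
  "below t = {a. \<forall>\<alpha>. cf a \<alpha> \<noteq> 0 \<longrightarrow> weight \<alpha> < t}"

lemma below_zero [simp]: "0 \<in> below t"
  by (simp add: below_def)

lemma below_add:
  assumes "a \<in> below t" "b \<in> below t"
  shows "a + b \<in> below t"
proof -
  have "weight \<alpha> < t" if "cf a \<alpha> + cf b \<alpha> \<noteq> 0" for \<alpha>
    using that assms by (cases "cf a \<alpha> = 0") (simp_all add: below_def)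
  then show ?thesis by (simp add: below_def cf_add)
qed

lemma below_mult_R:
  assumes "r \<in> R" "a \<in> below t"
  shows "r * a \<in> below t"
proof -
  have "weight \<alpha> < t" if "r * cf a \<alpha> \<noteq> 0" for \<alpha>
    using that assms by (cases "cf a \<alpha> = 0") (simp_all add: below_def)
  then show ?thesis using assms by (simp add: below_def cf_mult)
qed

lemma below_mono: "a \<in> below s \<Longrightarrow> s \<le> t \<Longrightarrow> a \<in> below t"
  by (force simp: below_def)

lemma below_sum: "(\<And>i. i \<in> T \<Longrightarrow> f i \<in> below t) \<Longrightarrow> sum f T \<in> below t"
  by (induction T rule: infinite_finite_induct) (simp_all add: below_add)

lemma X_below: "\<alpha> \<in> exps nvars \<Longrightarrow> weight \<alpha> < t \<Longrightarrow> X \<alpha> \<in> below t"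
  by (auto simp: below_def cf_X split: if_splits)

lemma below_induct [consumes 1, case_names add monomial]:
  assumes "a \<in> below t"
    and add: "\<And>a b. P a \<Longrightarrow> P b \<Longrightarrow> P (a + b)"
    and monomial: "\<And>r \<alpha>. r \<in> R \<Longrightarrow> \<alpha> \<in> exps nvars \<Longrightarrow> weight \<alpha> < t \<or> r = 0 \<Longrightarrow> P (r * X \<alpha>)"
  shows "P a"
proof -
  have P0: "P 0" using monomial[of 0 "\<lambda>_. 0"] by (simp add: exps_def)
  have "P (cf a \<alpha> * X \<alpha>)" if "cf a \<alpha> \<noteq> 0" for \<alpha>
    by (rule monomial[OF cf_R cf_exps[OF that]]) (use that assms(1) in \<open>simp add: below_def\<close>)
  note mon = this
  have "P (\<Sum>\<alpha>\<in>T. cf a \<alpha> * X \<alpha>)" if "finite T" "T \<subseteq> {\<alpha>. cf a \<alpha> \<noteq> 0}" for T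
    using that
  proof (induction T rule: finite_induct)
    case (insert \<alpha> T)
    have "P (cf a \<alpha> * X \<alpha> + (\<Sum>\<alpha>\<in>T. cf a \<alpha> * X \<alpha>))"
      by (rule add[OF mon insert.IH]) (use insert.prems in auto)
    then show ?case using insert.hyps by simp
  qed (simp add: P0)
  from this[OF finite_cf] have "P (\<Sum>\<alpha> | cf a \<alpha> \<noteq> 0. cf a \<alpha> * X \<alpha>)" by simp
  then show ?thesis by (simp only: expand[OF finite_cf order_refl, symmetric])
qed

section \<open>Moving elements across powers of the shift variables\<close>

text \<open>
  The two halves of a monomial. Each half is multiplicative in the exponent, because the variables in
  it commute; across the two halves this fails.
\<close>

definition Spow :: "(nat \<Rightarrow> nat) \<Rightarrow> 'a" where
  "Spow \<alpha> = prod_list (map (\<lambda>j. gens j ^ \<alpha> j) [1..<Suc m])"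
definition Dpow :: "(nat \<Rightarrow> nat) \<Rightarrow> 'a" where
  "Dpow \<alpha> = prod_list (map (\<lambda>j. gens j ^ \<alpha> j) [Suc m..<Suc nvars])"

lemma X_eq: "X \<alpha> = Spow \<alpha> * Dpow \<alpha>"
proof -
  have "[1..<Suc nvars] = [1..<Suc m] @ [Suc m..<Suc nvars]"
    using upt_add_eq_append[of 1 "Suc m" n] by simp
  then show ?thesis by (simp only: xpow_def Spow_def Dpow_def map_append prod_list.append)
qed

lemma Spow_add: "Spow (\<lambda>j. \<alpha> j + \<beta> j) = Spow \<alpha> * Spow \<beta>"
  unfolding Spow_def by (rule prod_list_power_add) (auto simp: dd_gens_def intro!: S_commute)

lemma Dpow_add: "Dpow (\<lambda>j. \<alpha> j + \<beta> j) = Dpow \<alpha> * Dpow \<beta>"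
  unfolding Dpow_def by (rule prod_list_power_add) (auto simp: dd_gens_def intro!: D_commute)

definition unit_exp :: "nat \<Rightarrow> nat \<Rightarrow> nat" where "unit_exp i = (\<lambda>j. if j = i then 1 else 0)"

lemma prod_list_unit_exp:
  "distinct js \<Longrightarrow> prod_list (map (\<lambda>j. gens j ^ unit_exp i j) js) = (if i \<in> set js then gens i else 1)"
  by (induction js) (auto simp: unit_exp_def)

lemma Spow_unit: "Spow (unit_exp i) = (if i \<in> {1..m} then gens i else 1)"
  and Dpow_unit: "Dpow (unit_exp i) = (if i \<in> {Suc m..nvars} then gens i else 1)"
  unfolding Spow_def Dpow_def by (subst prod_list_unit_exp; auto)+

lemma unit_exp_exps: "i \<in> {1..nvars} \<Longrightarrow> unit_exp i \<in> exps nvars"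
  by (auto simp: exps_def unit_exp_def)

lemma exps_add: "\<alpha> \<in> exps nvars \<Longrightarrow> \<beta> \<in> exps nvars \<Longrightarrow> (\<lambda>j. \<alpha> j + \<beta> j) \<in> exps nvars"
  by (auto simp: exps_def)

lemma weight_add: "weight (\<lambda>j. \<alpha> j + \<beta> j) = weight \<alpha> + weight \<beta>"
  by (simp add: weight_def sum.distrib)

lemma weight_unit: "i \<in> {1..nvars} \<Longrightarrow> weight (unit_exp i) = 1"
  by (simp add: weight_def unit_exp_def)

text \<open>
  Every \<open>\<sigma>\<^sub>i\<close> is a bijection of \<open>R\<close> that fixes \<open>0\<close>, so a nonzero scalar stays nonzero in both
  directions. This keeps leading coefficients nonzero later on.
\<close>

lemma R_push_S: "r \<in> R - {0} \<Longrightarrow> i \<in> {1..m} \<Longrightarrow> \<exists>r'\<in>R - {0}. r * S i = S i * r'"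
  and R_pull_S: "r \<in> R - {0} \<Longrightarrow> i \<in> {1..m} \<Longrightarrow> \<exists>r'\<in>R - {0}. S i * r = r' * S i"
proof -
  assume i: "i \<in> {1..m}" and r: "r \<in> R - {0}"
  have bij: "bij_betw (\<sigma> i) R R" and sc: "\<And>c a. a \<in> R \<Longrightarrow> \<sigma> i (scale c a) = scale c (\<sigma> i a)"
    using automorphism_R[OF i] by (auto simp: automorphism_on_def)
  have 0: "\<sigma> i 0 = 0" using sc[of 0 0] by simp
  have "\<sigma> i r \<noteq> 0"
    using bij 0 r by (metis DiffE R_0 bij_betw_imp_inj_on inj_on_eq_iff singletonI)
  moreover have "\<sigma> i r \<in> R" using bij r by (auto dest: bij_betwE)
  ultimately show "\<exists>r'\<in>R - {0}. r * S i = S i * r'" using R_S[OF i, of r] r by auto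
  obtain r' where r': "r' \<in> R" "\<sigma> i r' = r"
    using bij r by (metis DiffD1 bij_betw_imp_surj_on imageE)
  then have "S i * r = r' * S i" using R_S[OF i] by simp
  moreover have "r' \<noteq> 0" using r' r 0 by auto
  ultimately show "\<exists>r'\<in>R - {0}. S i * r = r' * S i" using r' by blast
qed

lemma Spow_letters: "\<exists>ys. Spow \<alpha> = prod_list ys \<and> set ys \<subseteq> S ` {1..m}"
proof (intro exI conjI)
  show "Spow \<alpha> = prod_list (map gens (letters \<alpha> [1..<Suc m]))"
    unfolding Spow_def by (rule prod_list_letters)
  have "gens ` {1..m} = S ` {1..m}" by (simp add: dd_gens_def)
  then show "set (map gens (letters \<alpha> [1..<Suc m])) \<subseteq> S ` {1..m}"
    using set_letters[of \<alpha> "[1..<Suc m]"] by (auto simp: dd_gens_def)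
qed

lemma push_Spow:
  assumes "\<And>c i. c \<in> C \<Longrightarrow> i \<in> {1..m} \<Longrightarrow> \<exists>c'\<in>C. c * S i = S i * c'" and "c \<in> C"
  shows "\<exists>c'\<in>C. c * Spow \<alpha> = Spow \<alpha> * c'"
proof -
  obtain ys where ys: "Spow \<alpha> = prod_list ys" "set ys \<subseteq> S ` {1..m}" using Spow_letters by blast
  show ?thesis unfolding ys(1) by (rule push_prod_list) (use ys(2) assms in blast)+
qed

lemma pull_Spow:
  assumes "\<And>c i. c \<in> C \<Longrightarrow> i \<in> {1..m} \<Longrightarrow> \<exists>c'\<in>C. S i * c = c' * S i" and "c \<in> C"
  shows "\<exists>c'\<in>C. Spow \<alpha> * c = c' * Spow \<alpha>"
proof -
  obtain ys where ys: "Spow \<alpha> = prod_list ys" "set ys \<subseteq> S ` {1..m}" using Spow_letters by blast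
  show ?thesis unfolding ys(1) by (rule pull_prod_list) (use ys(2) assms in blast)+
qed

lemma R_push_Spow: "r \<in> R - {0} \<Longrightarrow> \<exists>r'\<in>R - {0}. r * Spow \<alpha> = Spow \<alpha> * r'"
  by (rule push_Spow[OF R_push_S])

lemma R_pull_Spow: "r \<in> R - {0} \<Longrightarrow> \<exists>r'\<in>R - {0}. Spow \<alpha> * r = r' * Spow \<alpha>"
  by (rule pull_Spow[OF R_pull_S])

lemma R_pull_Spow': "r \<in> R \<Longrightarrow> \<exists>r'\<in>R. Spow \<alpha> * r = r' * Spow \<alpha>"
  using R_pull_Spow[of r \<alpha>] by (cases "r = 0") (auto intro: bexI[of _ 0])

definition D_forms :: "'a set" where
  "D_forms = {\<Sum>s=1..n. a s * D s | a. \<forall>s. a s \<in> R}"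

text \<open>
  This is where \<open>\<sigma>\<^sub>i (D\<^sub>j)\<close> being a linear form in the \<open>D\<close>'s enters: moving a \<open>D\<close> to the right across
  powers of the \<open>S\<close>'s does not increase the degree.
\<close>

lemma D_forms_push_S:
  assumes w: "w \<in> D_forms" and i: "i \<in> {1..m}"
  shows "\<exists>w'\<in>D_forms. w * S i = S i * w'"
proof -
  obtain a where a: "\<And>s. a s \<in> R" "w = (\<Sum>s=1..n. a s * D s)"
    using w by (auto simp: D_forms_def)
  have "\<forall>j. \<exists>b. (\<forall>s\<in>{1..n}. b s \<in> R) \<and> (j \<in> {1..n} \<longrightarrow> \<sigma> i (D j) = (\<Sum>s=1..n. b s * D s))"
    using \<sigma>_D[OF i] by (metis R_0)
  then obtain b where b: "\<And>j s. s \<in> {1..n} \<Longrightarrow> b j s \<in> R"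
    "\<And>j. j \<in> {1..n} \<Longrightarrow> \<sigma> i (D j) = (\<Sum>s=1..n. b j s * D s)" by metis
  have sR: "\<sigma> i r \<in> R" if "r \<in> R" for r
    using automorphism_R[OF i] that by (auto simp: automorphism_on_def dest: bij_betwE)
  define c where "c s = (if s \<in> {1..n} then \<Sum>j=1..n. \<sigma> i (a j) * b j s else 0)" for s
  have Rsum: "sum f T \<in> R" if "\<And>j. j \<in> T \<Longrightarrow> f j \<in> R" for f and T :: "nat set"
    using that by (induction T rule: infinite_finite_induct) (auto intro: R_add)
  have cR: "c s \<in> R" for s unfolding c_def using b a sR by (auto intro!: Rsum R_mult)
  have "w * S i = (\<Sum>j=1..n. a j * (D j * S i))"
    by (simp add: a sum_distrib_right mult.assoc)
  also have "\<dots> = (\<Sum>j=1..n. S i * (\<sigma> i (a j) * (\<Sum>s=1..n. b j s * D s)))"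
  proof (rule sum.cong)
    fix j assume j: "j \<in> {1..n}"
    show "a j * (D j * S i) = S i * (\<sigma> i (a j) * (\<Sum>s=1..n. b j s * D s))"
      by (simp only: D_S[OF j i] b(2)[OF j] R_S[OF i a(1)] flip: mult.assoc)
  qed simp
  also have "\<dots> = S i * (\<Sum>j=1..n. \<Sum>s=1..n. \<sigma> i (a j) * b j s * D s)"
    by (simp add: sum_distrib_left mult.assoc)
  also have "(\<Sum>j=1..n. \<Sum>s=1..n. \<sigma> i (a j) * b j s * D s) = (\<Sum>s=1..n. c s * D s)"
    by (subst sum.swap) (auto intro!: sum.cong simp: c_def sum_distrib_right)
  finally show ?thesis using cR by (auto simp: D_forms_def)
qed

lemma D_forms_push_Spow: "w \<in> D_forms \<Longrightarrow> \<exists>w'\<in>D_forms. w * Spow \<alpha> = Spow \<alpha> * w'"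
  by (rule push_Spow[OF D_forms_push_S])

abbreviation "RD \<equiv> generated_subalgebra (R \<union> D ` {1..n})"

lemma RD_subalgebra: "subalgebra RD" and RD_superset: "R \<union> D ` {1..n} \<subseteq> RD"
  and RD_minimal: "subalgebra B \<Longrightarrow> R \<union> D ` {1..n} \<subseteq> B \<Longrightarrow> RD \<subseteq> B"
  unfolding generated_subalgebra_def by (auto simp: subalgebra_def subspace_def)

text \<open>
  The rule holds for the generators by assumption, and the elements for which it holds form a
  subalgebra because \<open>\<sigma>\<^sub>i\<close> is a homomorphism.
\<close>

lemma RD_push_S:
  assumes i: "i \<in> {1..m}" and w: "w \<in> RD"
  shows "w * S i = S i * \<sigma> i w"
proof -
  have au: "automorphism_on RD (\<sigma> i)" by (rule automorphism[OF i])
  have sc: "\<And>c a. a \<in> RD \<Longrightarrow> \<sigma> i (scale c a) = scale c (\<sigma> i a)"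
    and ad: "\<And>a b. a \<in> RD \<Longrightarrow> b \<in> RD \<Longrightarrow> \<sigma> i (a + b) = \<sigma> i a + \<sigma> i b"
    and mu: "\<And>a b. a \<in> RD \<Longrightarrow> b \<in> RD \<Longrightarrow> \<sigma> i (a * b) = \<sigma> i a * \<sigma> i b" and one: "\<sigma> i 1 = 1"
    using au by (auto simp: automorphism_on_def)
  have RD: "0 \<in> RD" "1 \<in> RD" "\<And>a b. a \<in> RD \<Longrightarrow> b \<in> RD \<Longrightarrow> a + b \<in> RD"
    "\<And>a b. a \<in> RD \<Longrightarrow> b \<in> RD \<Longrightarrow> a * b \<in> RD" "\<And>c a. a \<in> RD \<Longrightarrow> scale c a \<in> RD"
    using RD_subalgebra by (auto simp: subalgebra_def subspace_def)
  have 0: "\<sigma> i 0 = 0" using sc[of 0 0] RD by simp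
  let ?B = "{w \<in> RD. w * S i = S i * \<sigma> i w}"
  have "subalgebra ?B"
    unfolding subalgebra_def subspace_def
  proof (intro conjI ballI allI)
    fix a b assume "a \<in> ?B" "b \<in> ?B"
    then have ab: "a \<in> RD" "b \<in> RD" "a * S i = S i * \<sigma> i a" "b * S i = S i * \<sigma> i b" by auto
    have "a * b * S i = a * S i * \<sigma> i b" using ab(4) by (simp only: mult.assoc)
    also have "\<dots> = S i * \<sigma> i (a * b)" by (simp only: ab(3) mu[OF ab(1,2)] mult.assoc)
    finally have "a * b * S i = S i * \<sigma> i (a * b)" .
    then show "a * b \<in> ?B" using ab RD by simp
    show "a + b \<in> ?B" using ab RD by (simp add: ad distrib_left distrib_right)
  next
    fix c a assume "a \<in> ?B"
    then show "scale c a \<in> ?B"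
      using RD by (simp add: sc flip: scale_mult_left scale_mult_right)
  qed (use 0 one RD in simp_all)
  moreover have "R \<union> D ` {1..n} \<subseteq> ?B"
  proof
    fix w assume w: "w \<in> R \<union> D ` {1..n}"
    then have "w * S i = S i * \<sigma> i w"
    proof
      assume "w \<in> R" then show ?thesis by (rule R_S[OF i])
    next
      assume "w \<in> D ` {1..n}"
      then obtain j where "j \<in> {1..n}" "w = D j" by blast
      then show ?thesis using D_S[OF _ i] by simp
    qed
    then show "w \<in> ?B" using RD_superset w by blast
  qed
  ultimately have "RD \<subseteq> ?B" by (rule RD_minimal)
  with w show ?thesis by blast
qed

text \<open>
  As \<open>\<sigma>\<^sub>i\<close> is onto, the previous rule can be read backwards: \<open>S\<^sub>i b = w S\<^sub>i\<close> for the preimage \<open>w\<close> of \<open>b\<close>.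
\<close>

lemma RD_pull_S:
  assumes i: "i \<in> {1..m}" and b: "b \<in> RD"
  shows "\<exists>w\<in>RD. S i * b = w * S i"
proof -
  have "bij_betw (\<sigma> i) RD RD" using automorphism[OF i] by (simp add: automorphism_on_def)
  then obtain w where "w \<in> RD" "\<sigma> i w = b" using b by (metis bij_betw_imp_surj_on imageE)
  then have "S i * b = w * S i" using RD_push_S[OF i] by simp
  with \<open>w \<in> RD\<close> show ?thesis by blast
qed

lemma RD_pull_Spow: "b \<in> RD \<Longrightarrow> \<exists>w\<in>RD. Spow \<alpha> * b = w * Spow \<alpha>"
  by (rule pull_Spow[OF RD_pull_S])

lemma Dpow_RD: "Dpow \<alpha> \<in> RD"
proof -
  have "prod_list (map gens js) \<in> RD" if "set js \<subseteq> {Suc m..nvars}" for js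
    using that
  proof (induction js)
    case Nil
    then show ?case using RD_subalgebra by (simp add: subalgebra_def)
  next
    case (Cons j js)
    then have "gens j = D (j - m)" "j - m \<in> {1..n}" by (auto simp: dd_gens_def)
    then have "gens j \<in> D ` {1..n}" by blast
    then have "gens j \<in> RD" using RD_superset by blast
    moreover have "prod_list (map gens js) \<in> RD" using Cons by simp
    ultimately show ?case using RD_subalgebra by (simp add: subalgebra_def)
  qed
  moreover have "set (letters \<alpha> [Suc m..<Suc nvars]) \<subseteq> {Suc m..nvars}"
    using set_letters[of \<alpha> "[Suc m..<Suc nvars]"] by (simp add: atLeastLessThanSuc_atLeastAtMost del: upt_Suc)
  ultimately show ?thesis unfolding Dpow_def prod_list_letters by blast
qed

lemma S_mult_X: "i \<in> {1..m} \<Longrightarrow> S i * X \<alpha> = X (\<lambda>j. unit_exp i j + \<alpha> j)"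
  by (simp add: X_eq Spow_add Dpow_add Spow_unit Dpow_unit dd_gens_def mult.assoc)

section \<open>Products and the filtration\<close>

text \<open>
  Moving \<open>D\<^sub>i\<close> across the \<open>S\<close> part turns it into a linear form in the \<open>D\<close>'s; each of its terms
  then joins the \<open>D\<close> part of the monomial, and its coefficient returns to the far left.
\<close>

lemma D_mult_X_below:
  assumes i: "i \<in> {1..n}" and \<alpha>: "\<alpha> \<in> exps nvars"
  shows "D i * X \<alpha> \<in> below (weight \<alpha> + 2)"
proof -
  have "D i = (\<Sum>s=1..n. (if s = i then 1 else 0) * D s)"
    using i by (simp add: if_distrib[of "\<lambda>c. c * _"] cong: if_cong)
  then have "D i \<in> D_forms"
    unfolding D_forms_def by (intro CollectI exI[of _ "\<lambda>s. if s = i then 1 else 0"]) simp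
  then obtain w where w: "w \<in> D_forms" "D i * Spow \<alpha> = Spow \<alpha> * w"
    using D_forms_push_Spow by blast
  then obtain a where a: "\<And>s. a s \<in> R" "w = (\<Sum>s=1..n. a s * D s)"
    by (auto simp: D_forms_def)
  \<comment> \<open>One term \<open>a s * D s\<close> of the linear form that \<open>D i\<close> has become.\<close>
  have summand: "Spow \<alpha> * (a s * D s) * Dpow \<alpha> \<in> below (weight \<alpha> + 2)" if s: "s \<in> {1..n}" for s
  proof -
    obtain r where r: "r \<in> R" "Spow \<alpha> * a s = r * Spow \<alpha>" using R_pull_Spow' a(1) by blast
    let ?\<beta> = "\<lambda>j. unit_exp (m + s) j + \<alpha> j"
    have ms: "m + s \<in> {1..nvars}" "m + s \<in> {Suc m..nvars}" "m + s \<notin> {1..m}" using s by auto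
    have shift: "D s * Dpow \<alpha> = Dpow ?\<beta>" "Spow \<alpha> = Spow ?\<beta>"
      using s by (simp_all add: Dpow_add Spow_add Dpow_unit Spow_unit dd_gens_def)
    have "Spow \<alpha> * (a s * D s) * Dpow \<alpha> = Spow \<alpha> * a s * (D s * Dpow \<alpha>)"
      by (simp only: mult.assoc)
    also have "\<dots> = r * Spow \<alpha> * Dpow ?\<beta>" by (simp only: r(2) shift(1))
    also have "\<dots> = r * X ?\<beta>" by (simp only: X_eq mult.assoc flip: shift(2))
    finally have "Spow \<alpha> * (a s * D s) * Dpow \<alpha> = r * X ?\<beta>" .
    moreover have "X ?\<beta> \<in> below (weight \<alpha> + 2)"
      using ms \<alpha> by (intro X_below exps_add unit_exp_exps) (simp_all add: weight_add weight_unit)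
    ultimately show ?thesis using r(1) by (simp add: below_mult_R)
  qed
  have "D i * X \<alpha> = Spow \<alpha> * w * Dpow \<alpha>"
    by (simp only: X_eq w(2) flip: mult.assoc)
  also have "\<dots> = (\<Sum>s=1..n. Spow \<alpha> * (a s * D s) * Dpow \<alpha>)"
    by (simp only: a(2) sum_distrib_left sum_distrib_right)
  also have "\<dots> \<in> below (weight \<alpha> + 2)" by (intro below_sum summand)
  finally show ?thesis .
qed

lemma gens_mult_below:
  assumes i: "i \<in> {1..nvars}" and "a \<in> below t"
  shows "gens i * a \<in> below (Suc t)"
  using assms(2)
proof (induction rule: below_induct)
  case (add a b)
  then show ?case by (simp add: distrib_left below_add)
next
  case (monomial r \<alpha>)
  show ?case
  proof (cases "r = 0")
    case False
    then have t: "weight \<alpha> < t" using monomial by simp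
    show ?thesis
    proof (cases "i \<le> m")
      case True
      then have im: "i \<in> {1..m}" using i by simp
      obtain r' where r': "r' \<in> R" "S i * r = r' * S i"
        using R_pull_S[OF _ im, of r] False monomial(1) by blast
      have "gens i * (r * X \<alpha>) = r' * (S i * X \<alpha>)"
        using True r'(2) by (simp add: dd_gens_def flip: mult.assoc)
      also have "\<dots> = r' * X (\<lambda>j. unit_exp i j + \<alpha> j)" by (simp only: S_mult_X[OF im])
      also have "\<dots> \<in> below (Suc t)"
        using i t monomial(2) r'(1) unfolding S_mult_X[OF im]
        by (intro below_mult_R X_below exps_add unit_exp_exps) (simp_all add: weight_add weight_unit)
      finally show ?thesis .
    next
      case False
      then have im: "i - m \<in> {1..n}" using i by auto
      have \<delta>R: "\<delta> (i - m) r \<in> R"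
        using derivation[OF im] monomial(1) by (simp add: derivation_on_def)
      have "gens i * (r * X \<alpha>) = D (i - m) * r * X \<alpha>"
        using False by (simp add: dd_gens_def mult.assoc)
      also have "\<dots> = r * (D (i - m) * X \<alpha>) + \<delta> (i - m) r * X \<alpha>"
        by (simp only: D_R[OF im monomial(1)] distrib_right mult.assoc)
      also have "\<dots> \<in> below (Suc t)"
      proof (rule below_add[OF below_mult_R[OF monomial(1)] below_mult_R[OF \<delta>R]])
        show "D (i - m) * X \<alpha> \<in> below (Suc t)"
          by (rule below_mono[OF D_mult_X_below[OF im monomial(2)]]) (use t in simp)
        show "X \<alpha> \<in> below (Suc t)" using t monomial by (intro X_below) auto
      qed
      finally show ?thesis .
    qed
  qed simp
qed

lemma word_mult_below:
  "set js \<subseteq> {1..nvars} \<Longrightarrow> b \<in> below t \<Longrightarrow> prod_list (map gens js) * b \<in> below (length js + t)"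
proof (induction js)
  case (Cons j js)
  then have "gens j * (prod_list (map gens js) * b) \<in> below (Suc (length js + t))"
    by (intro gens_mult_below) auto
  then show ?case by (simp add: mult.assoc)
qed simp

lemma letters_upt:
  "prod_list (map (\<lambda>j. gens j ^ \<alpha> j) [a..<Suc b]) = prod_list (map gens (letters \<alpha> [a..<Suc b]))"
  "set (letters \<alpha> [a..<Suc b]) \<subseteq> {a..b}" "length (letters \<alpha> [a..<Suc b]) = sum \<alpha> {a..b}"
  using set_letters[of \<alpha> "[a..<Suc b]"]
  by (auto simp: prod_list_letters length_letters interv_sum_list_conv_sum_set_nat
      atLeastLessThanSuc_atLeastAtMost simp del: upt_Suc)

lemma Spow_mult_below: "b \<in> below t \<Longrightarrow> Spow \<alpha> * b \<in> below (sum \<alpha> {1..m} + t)"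
  and Dpow_mult_below: "b \<in> below t \<Longrightarrow> Dpow \<alpha> * b \<in> below (sum \<alpha> {Suc m..nvars} + t)"
  and X_mult_below: "b \<in> below t \<Longrightarrow> X \<alpha> * b \<in> below (weight \<alpha> + t)"
proof -
  assume b: "b \<in> below t"
  have "prod_list (map (\<lambda>j. gens j ^ \<alpha> j) [u..<Suc v]) * b \<in> below (sum \<alpha> {u..v} + t)"
    if "1 \<le> u" "v \<le> nvars" for u v
    using word_mult_below[OF _ b, of "letters \<alpha> [u..<Suc v]"] letters_upt[of \<alpha> u v] that by force
  from this[of 1 m] this[of "Suc m" nvars] this[of 1 nvars]
  show "Spow \<alpha> * b \<in> below (sum \<alpha> {1..m} + t)" "Dpow \<alpha> * b \<in> below (sum \<alpha> {Suc m..nvars} + t)"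
    "X \<alpha> * b \<in> below (weight \<alpha> + t)"
    by (simp_all add: Spow_def Dpow_def xpow_def weight_def del: upt_Suc)
qed

lemma mult_below:
  assumes a: "a \<in> below s" and b: "b \<in> below (Suc t)"
  shows "a * b \<in> below (s + t)"
  using a
proof (induction rule: below_induct)
  case (add a1 a2)
  then show ?case by (simp add: distrib_right below_add)
next
  case (monomial r \<alpha>)
  show ?case
  proof (cases "r = 0")
    case False
    then have "X \<alpha> * b \<in> below (s + t)"
      using monomial(3) by (intro below_mono[OF X_mult_below[OF b]]) simp
    then show ?thesis using monomial(1) by (simp add: below_mult_R mult.assoc)
  qed simp
qed

lemma R_below: "r \<in> R \<Longrightarrow> r \<in> below (Suc 0)"
proof -
  assume "r \<in> R"
  have "prod_list (map (\<lambda>j. gens j ^ 0) js) = 1" for js by (induction js) auto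
  then have "X (\<lambda>_. 0) = 1" by (simp only: xpow_def)
  then have "1 \<in> below (Suc 0)"
    using X_below[of "\<lambda>_. 0" "Suc 0"] by (simp add: exps_def weight_def)
  from below_mult_R[OF \<open>r \<in> R\<close> this] show ?thesis by simp
qed

text \<open>
  Each commutation \<open>D r = r D + \<delta>(r)\<close> leaves an error of smaller degree, so products of \<open>D\<close>'s commute
  with scalars up to smaller degree. Since the total degree comes first in the monomial ordering,
  such errors never interfere with leading monomials.
\<close>

lemma D_word_commutator:
  assumes "set js \<subseteq> {Suc m..nvars}" and r: "r \<in> R"
  shows "prod_list (map gens js) * r - r * prod_list (map gens js) \<in> below (length js)"
  using assms(1)
proof (induction js)
  case (Cons j js)
  let ?w = "prod_list (map gens js)"
  have j: "j - m \<in> {1..n}" "j \<in> {1..nvars}" and gj: "gens j = D (j - m)"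
    using Cons.prems by (auto simp: dd_gens_def)
  have js: "set js \<subseteq> {1..nvars}" using Cons.prems by auto
  have \<delta>R: "\<delta> (j - m) r \<in> R"
    using derivation[OF j(1)] r by (simp add: derivation_on_def)
  have Dr: "gens j * r = r * gens j + \<delta> (j - m) r" using D_R[OF j(1) r] by (simp add: gj)
  have "gens j * ?w * r - r * (gens j * ?w) = gens j * (?w * r - r * ?w) + (gens j * r - r * gens j) * ?w"
    by (simp add: algebra_simps)
  also have "\<dots> = gens j * (?w * r - r * ?w) + \<delta> (j - m) r * ?w"
    by (simp add: Dr)
  also have "\<dots> \<in> below (Suc (length js))"
  proof (rule below_add[OF gens_mult_below[OF j(2)] below_mult_R[OF \<delta>R]])
    show "?w * r - r * ?w \<in> below (length js)" using Cons by simp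
    show "?w \<in> below (Suc (length js))"
      using word_mult_below[OF js R_below[OF R_1]] by simp
  qed
  finally show ?case by simp
qed simp

lemma Dpow_commutator: "r \<in> R \<Longrightarrow> Dpow \<alpha> * r - r * Dpow \<alpha> \<in> below (sum \<alpha> {Suc m..nvars})"
  using D_word_commutator[of "letters \<alpha> [Suc m..<Suc nvars]" r] letters_upt[of \<alpha> "Suc m" nvars]
  by (simp add: Dpow_def del: upt_Suc)

lemma weight_split: "weight \<alpha> = sum \<alpha> {1..m} + sum \<alpha> {Suc m..nvars}"
proof -
  have "{1..nvars} = {1..m} \<union> {Suc m..nvars}" by auto
  then show ?thesis unfolding weight_def by (simp add: sum.union_disjoint)
qed

text \<open>
  The substitute for divisibility of monomials. The obvious candidate \<open>h = X\<^bsup>\<alpha> - \<beta>\<^esup>\<close> fails: the \<open>\<sigma>\<close>'s may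
  permute the \<open>D\<close>'s, and then \<open>h X\<^sup>\<beta>\<close> is a different monomial of the same degree. Instead take
  \<open>h = S\<^sup>\<gamma> w\<close> with \<open>\<gamma> = \<alpha> - \<beta>\<close>, where \<open>w S\<^sup>\<beta> = S\<^sup>\<beta> D\<^sup>\<gamma>\<close>; such a \<open>w\<close> exists as powers of the \<open>S\<close>'s can be
  moved across the subalgebra generated by \<open>R\<close> and the \<open>D\<close>'s. One \<open>h\<close> has to serve all \<open>r\<close>, because
  multiplying by \<open>h\<close> meets every coefficient of an element of \<open>A\<^sup>p\<close>.
\<close>

lemma raise_monomial:
  assumes \<beta>\<alpha>: "\<And>j. \<beta> j \<le> \<alpha> j"
  shows "\<exists>h. \<forall>r\<in>R - {0}. \<exists>s\<in>R - {0}. h * r * X \<beta> - s * X \<alpha> \<in> below (weight \<alpha>)"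
proof -
  define \<gamma> where "\<gamma> j = \<alpha> j - \<beta> j" for j
  have \<alpha>_eq: "\<alpha> = (\<lambda>j. \<gamma> j + \<beta> j)" using \<beta>\<alpha> by (auto simp: \<gamma>_def)
  obtain w where w: "Spow \<beta> * Dpow \<gamma> = w * Spow \<beta>"
    using RD_pull_Spow[OF Dpow_RD] by blast
  have "\<exists>s\<in>R - {0}. (Spow \<gamma> * w) * r * X \<beta> - s * X \<alpha> \<in> below (weight \<alpha>)" if r: "r \<in> R - {0}" for r
  proof -
    obtain r1 where r1: "r1 \<in> R - {0}" "r * Spow \<beta> = Spow \<beta> * r1" using R_push_Spow[OF r] by blast
    obtain s where s: "s \<in> R - {0}" "Spow \<alpha> * r1 = s * Spow \<alpha>" using R_pull_Spow[OF r1(1)] by blast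
    \<comment> \<open>The error from exchanging \<open>D\<^sup>\<gamma>\<close> and the scalar \<open>r1\<close>, of degree smaller than that of \<open>D\<^sup>\<gamma>\<close>.\<close>
    define e where "e = Dpow \<gamma> * r1 - r1 * Dpow \<gamma>"
    have e: "e \<in> below (sum \<gamma> {Suc m..nvars})" using Dpow_commutator r1(1) by (simp add: e_def)
    have "(Spow \<gamma> * w) * r * X \<beta> = Spow \<gamma> * w * (r * Spow \<beta>) * Dpow \<beta>"
      by (simp only: X_eq mult.assoc)
    also have "\<dots> = Spow \<gamma> * (w * Spow \<beta>) * r1 * Dpow \<beta>"
      by (simp only: r1(2) mult.assoc)
    also have "\<dots> = (Spow \<gamma> * Spow \<beta>) * (Dpow \<gamma> * r1) * Dpow \<beta>"
      by (simp only: w[symmetric] mult.assoc)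
    also have "\<dots> = Spow \<alpha> * (r1 * Dpow \<gamma> + e) * Dpow \<beta>"
      by (simp only: \<alpha>_eq Spow_add e_def) simp
    also have "\<dots> = Spow \<alpha> * r1 * (Dpow \<gamma> * Dpow \<beta>) + Spow \<alpha> * (e * Dpow \<beta>)"
      by (simp only: distrib_left distrib_right mult.assoc)
    also have "Spow \<alpha> * r1 * (Dpow \<gamma> * Dpow \<beta>) = s * X \<alpha>"
      by (simp only: s(2) X_eq \<alpha>_eq[symmetric] Dpow_add[symmetric] mult.assoc)
    finally have "(Spow \<gamma> * w) * r * X \<beta> - s * X \<alpha> = Spow \<alpha> * (e * Dpow \<beta>)" by simp
    also have "\<dots> \<in> below (sum \<alpha> {1..m} + (sum \<gamma> {Suc m..nvars} + sum \<beta> {Suc m..nvars}))"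
      using Dpow_mult_below[OF R_below[OF R_1], of \<beta>] by (intro Spow_mult_below mult_below e) simp
    also have "sum \<alpha> {1..m} + (sum \<gamma> {Suc m..nvars} + sum \<beta> {Suc m..nvars}) = weight \<alpha>"
      by (simp only: weight_split) (simp add: \<alpha>_eq sum.distrib)
    finally show ?thesis using s(1) by blast
  qed
  then show ?thesis by blast
qed

end

section \<open>Leading monomials in the free module\<close>

lemma linear_order_finite_max:
  assumes "linear_order_on M r" "finite A" "A \<noteq> {}" "A \<subseteq> M"
  shows "\<exists>u\<in>A. \<forall>v\<in>A. (v, u) \<in> r"
  using assms(2-4)
proof (induction A rule: finite_ne_induct)
  case (singleton u)
  then show ?case using assms(1)
    by (auto simp: linear_order_on_def partial_order_on_def preorder_on_def refl_on_def)
next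
  case (insert w A)
  then obtain u where u: "u \<in> A" "\<forall>v\<in>A. (v, u) \<in> r" by auto
  have refl: "(w, w) \<in> r" and tr: "trans r" and tot: "w \<noteq> u \<Longrightarrow> (w, u) \<in> r \<or> (u, w) \<in> r"
    using assms(1) insert.prems u(1)
    by (auto simp: linear_order_on_def partial_order_on_def preorder_on_def refl_on_def total_on_def)
  show ?case
  proof (cases "(w, u) \<in> r")
    case True
    then show ?thesis using u by blast
  next
    case False
    then have "(u, w) \<in> r" using tot u(1) refl by metis
    then have "\<forall>v\<in>A. (v, w) \<in> r" using u(2) tr by (meson transD)
    then show ?thesis using refl by blast
  qed
qed

context dd_field_algebra
begin

abbreviation vcoeff :: "'a ^ 'p \<Rightarrow> 'p::finite monom \<Rightarrow> 'a" where
  "vcoeff f u \<equiv> cf (f $ snd u) (fst u)"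
abbreviation supp :: "'a ^ 'p::finite \<Rightarrow> 'p monom set" where
  "supp \<equiv> support R nvars gens"
abbreviation mvec :: "'p::finite monom \<Rightarrow> 'a ^ 'p" where
  "mvec \<equiv> monom_vec nvars gens"

lemma in_supp: "u \<in> supp f \<longleftrightarrow> vcoeff f u \<noteq> 0"
  by (simp add: support_def)

lemma vec_eqI_vcoeff: "(\<And>u. vcoeff f u = vcoeff g u) \<Longrightarrow> f = g"
proof -
  assume eq: "\<And>u. vcoeff f u = vcoeff g u"
  have "f $ i - g $ i = 0" for i
    using eq[of "(_, i)"] by (subst cf_eq_0_iff[symmetric]) (simp add: cf_diff)
  then show ?thesis by (simp add: vec_eq_iff)
qed

lemma supp_empty_iff: "supp f = {} \<longleftrightarrow> f = 0"
  using vec_eqI_vcoeff[of f 0] by (auto simp: support_def)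

lemma supp_monomials: "supp f \<subseteq> monomials nvars"
  using cf_exps by (auto simp: support_def monomials_def)

lemma finite_supp: "finite (supp f)"
proof -
  have "supp f \<subseteq> (\<Union>i. (\<lambda>\<alpha>. (\<alpha>, i)) ` {\<alpha>. cf (f $ i) \<alpha> \<noteq> 0})"
    by (force simp: support_def image_iff)
  then show ?thesis by (rule finite_subset) (auto intro: finite_cf)
qed

lemma vcoeff_mult_R: "c \<in> R \<Longrightarrow> vcoeff (c *s f) u = c * vcoeff f u"
  by (simp add: cf_mult)

lemma vcoeff_mult_mvec: "vcoeff (a *s mvec u) w = (if snd w = snd u then cf (a * X (fst u)) (fst w) else 0)"
  by (simp add: monom_vec_def axis_def)

lemma vcoeff_mvec: "u \<in> monomials nvars \<Longrightarrow> vcoeff (mvec u) w = (if w = u then 1 else 0)"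
  by (auto simp: monom_vec_def axis_def cf_X monomials_def prod_eq_iff)

lemma vcoeff_sum: "vcoeff (sum f T) u = (\<Sum>i\<in>T. vcoeff (f i) u)"
  by (simp add: cf_sum)

lemma expand_vec:
  assumes "finite T" "supp f \<subseteq> T" "T \<subseteq> monomials nvars"
  shows "f = (\<Sum>u\<in>T. vcoeff f u *s mvec u)"
proof (rule vec_eqI_vcoeff)
  fix w
  have "vcoeff (\<Sum>u\<in>T. vcoeff f u *s mvec u) w = (\<Sum>u\<in>T. vcoeff f u * (if w = u then 1 else 0))"
    unfolding vcoeff_sum
  proof (rule sum.cong)
    fix u assume "u \<in> T"
    then have u: "u \<in> monomials nvars" using assms(3) by blast
    show "vcoeff (vcoeff f u *s mvec u) w = vcoeff f u * (if w = u then 1 else 0)"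
      by (simp only: vcoeff_mult_R[OF cf_R] vcoeff_mvec[OF u])
  qed simp
  also have "\<dots> = (\<Sum>u\<in>T. if w = u then vcoeff f u else 0)"
    by (intro sum.cong) auto
  also have "\<dots> = (if w \<in> T then vcoeff f w else 0)"
    using assms(1) by (rule sum.delta')
  also have "\<dots> = vcoeff f w" using assms(2) by (auto simp: support_def)
  finally show "vcoeff f w = vcoeff (\<Sum>u\<in>T. vcoeff f u *s mvec u) w" by simp
qed

lemma tdeg_weight: "tdeg nvars u = weight (fst u)"
  by (simp add: tdeg_def weight_def)

end

locale GS_module = dd_field_algebra scale R m n S D \<sigma> \<delta>
  for scale :: "'k::field \<Rightarrow> 'a::ring_1 \<Rightarrow> 'a" and R m n S D \<sigma> \<delta> +
  fixes N G :: "('a ^ 'p::finite) set" and ord :: "('p monom \<times> 'p monom) set"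
  assumes submodule: "left_submodule N"
    and DD: "DD_ordering R nvars gens ord"
    and total_degree: "total_degree_ordering nvars ord"
    and finite_G: "finite G"
    and GS: "GS_basis R nvars gens ord N G"
begin

abbreviation "LM \<equiv> lm R nvars gens ord"
abbreviation "IrrG \<equiv> Irr R nvars gens ord G"

lemma ord: "well_order_on (monomials nvars) ord"
  using DD by (simp add: DD_ordering_def)

lemma ord_linear: "linear_order_on (monomials nvars) ord" and ord_wf: "wf (ord - Id)"
  and ord_antisym: "(u, v) \<in> ord \<Longrightarrow> (v, u) \<in> ord \<Longrightarrow> u = v"
  and ord_trans: "(u, v) \<in> ord \<Longrightarrow> (v, w) \<in> ord \<Longrightarrow> (u, w) \<in> ord"
  and ord_refl: "u \<in> monomials nvars \<Longrightarrow> (u, u) \<in> ord"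
  using ord by (auto simp: well_order_on_def linear_order_on_def partial_order_on_def preorder_on_def
      refl_on_def dest: antisymD transD)

lemma ord_tdeg:
  assumes "(u, v) \<in> ord"
  shows "tdeg nvars u \<le> tdeg nvars v"
proof (rule ccontr)
  assume "\<not> ?thesis"
  moreover have "u \<in> monomials nvars" "v \<in> monomials nvars"
    using assms ord by (auto simp: well_order_on_def linear_order_on_def partial_order_on_def
        preorder_on_def refl_on_def)
  ultimately have "(v, u) \<in> ord" "u \<noteq> v"
    using total_degree by (auto simp: total_degree_ordering_def gt_def)
  then show False using assms ord_antisym by blast
qed

lemma tdeg_less_ord:
  "u \<in> monomials nvars \<Longrightarrow> v \<in> monomials nvars \<Longrightarrow> tdeg nvars u < tdeg nvars v \<Longrightarrow> (u, v) \<in> ord"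
  using total_degree by (auto simp: total_degree_ordering_def gt_def)

lemma LM_eqI: "u \<in> supp f \<Longrightarrow> (\<And>v. v \<in> supp f \<Longrightarrow> (v, u) \<in> ord) \<Longrightarrow> LM f = u"
  unfolding lm_def by (rule the_equality) (auto dest: ord_antisym)

lemma LM_supp: "f \<noteq> 0 \<Longrightarrow> LM f \<in> supp f"
  and LM_max: "v \<in> supp f \<Longrightarrow> (v, LM f) \<in> ord"
proof -
  have "LM f \<in> supp f \<and> (\<forall>v\<in>supp f. (v, LM f) \<in> ord)" if "supp f \<noteq> {}"
    using linear_order_finite_max[OF ord_linear finite_supp that supp_monomials] LM_eqI by metis
  then show "f \<noteq> 0 \<Longrightarrow> LM f \<in> supp f" "v \<in> supp f \<Longrightarrow> (v, LM f) \<in> ord"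
    using supp_empty_iff[of f] by auto
qed

text \<open>
  Take \<open>h\<close> from \<open>raise_monomial\<close> for the leading monomial \<open>v\<close> of \<open>g\<close>. Then \<open>h c v\<close> has leading monomial
  \<open>u\<close> for every nonzero scalar \<open>c\<close>. A lower term \<open>c w\<close> of \<open>g\<close> is handled by the ordering: multiplication
  by \<open>h c\<close> preserves \<open>w < v\<close>, so that the leading monomial of \<open>h c w\<close> is smaller than that of \<open>h c v\<close>,
  which is \<open>u\<close>, unless \<open>h c w\<close> vanishes.
\<close>

lemma LM_multiple:
  assumes g: "g \<noteq> 0" and u: "u \<in> monomials nvars" and dvd: "rdivides (LM g) u"
  shows "\<exists>h. vcoeff (h *s g) u \<noteq> 0 \<and> (\<forall>v\<in>supp (h *s g). (v, u) \<in> ord)"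
proof -
  let ?v = "LM g"
  have v: "?v \<in> supp g" "?v \<in> monomials nvars" using LM_supp[OF g] supp_monomials by auto
  have snd: "snd ?v = snd u" and le: "\<And>j. fst ?v j \<le> fst u j"
    using dvd by (auto simp: rdivides_def)
  obtain h where h: "\<And>c. c \<in> R - {0} \<Longrightarrow>
      \<exists>s\<in>R - {0}. h * c * X (fst ?v) - s * X (fst u) \<in> below (weight (fst u))"
    using raise_monomial[of "fst ?v" "fst u", OF le] by blast
  \<comment> \<open>The leading term of \<open>g\<close>, with an arbitrary coefficient \<open>c\<close>.\<close>
  have lead: "vcoeff ((h * c) *s mvec ?v) u \<noteq> 0 \<and> (\<forall>w\<in>supp ((h * c) *s mvec ?v). (w, u) \<in> ord)"
    if c: "c \<in> R - {0}" for c
  proof -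
    obtain s where s: "s \<in> R - {0}" "h * c * X (fst ?v) - s * X (fst u) \<in> below (weight (fst u))"
      using h[OF c] by blast
    define e where "e = h * c * X (fst ?v) - s * X (fst u)"
    have eq: "h * c * X (fst ?v) = s * X (fst u) + e" by (simp add: e_def)
    have e: "cf e \<alpha> \<noteq> 0 \<Longrightarrow> weight \<alpha> < weight (fst u)" for \<alpha>
      using s(2) by (simp add: below_def e_def)
    have uE: "fst u \<in> exps nvars" using u by (auto simp: monomials_def)
    have cf: "vcoeff ((h * c) *s mvec ?v) w =
        (if snd w = snd u then (if fst w = fst u then s else 0) + cf e (fst w) else 0)" for w
      unfolding vcoeff_mult_mvec snd eq using s(1) by (simp add: cf_add cf_mult cf_X[OF uE])
    have "cf e (fst u) = 0" using e by blast
    then have "vcoeff ((h * c) *s mvec ?v) u \<noteq> 0" using cf[of u] s(1) by simp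
    moreover have "(w, u) \<in> ord" if w: "w \<in> supp ((h * c) *s mvec ?v)" for w
    proof (cases "w = u")
      case True
      then show ?thesis using u by (simp add: ord_refl)
    next
      case False
      have wm: "w \<in> monomials nvars" using w supp_monomials by auto
      have "cf e (fst w) \<noteq> 0"
        using w False cf[of w] by (auto simp: in_supp prod_eq_iff split: if_splits)
      then have "tdeg nvars w < tdeg nvars u" using e by (simp add: tdeg_weight)
      then show ?thesis by (rule tdeg_less_ord[OF wm u])
    qed
    ultimately show ?thesis by blast
  qed
  have lower: "vcoeff ((h * vcoeff g w) *s mvec w) u = 0 \<and> (\<forall>y\<in>supp ((h * vcoeff g w) *s mvec w). (y, u) \<in> ord)"
    if w: "w \<in> supp g" "w \<noteq> ?v" for w
  \<comment> \<open>The leading monomial of \<open>0\<close> is an arbitrary value, so a vanishing product is a case of its own.\<close>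
  proof (cases "(h * vcoeff g w) *s mvec w = 0")
    case True
    then show ?thesis by (simp add: support_def)
  next
    case False
    let ?f = "h * vcoeff g w"
    have c: "vcoeff g w \<in> R - {0}" using w by (simp add: in_supp)
    have "gt ord ?v w" using LM_max[OF w(1)] w(2) by (simp add: gt_def)
    moreover have "?f \<noteq> 0" using lead[OF c] by (auto simp: support_def)
    moreover have "w \<in> monomials nvars" using w supp_monomials by auto
    ultimately have "gt ord (LM (?f *s mvec ?v)) (LM (?f *s mvec w))"
      using DD v(2) by (auto simp: DD_ordering_def)
    moreover have "LM (?f *s mvec ?v) = u"
      using lead[OF c] by (intro LM_eqI) (auto simp: in_supp)
    ultimately have lt: "(LM (?f *s mvec w), u) \<in> ord" "LM (?f *s mvec w) \<noteq> u"
      by (auto simp: gt_def)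
    have *: "(y, u) \<in> ord" if "y \<in> supp (?f *s mvec w)" for y
      using LM_max[OF that] lt(1) ord_trans by blast
    have "u \<notin> supp (?f *s mvec w)"
      using LM_max[of u "?f *s mvec w"] lt ord_antisym by blast
    then show ?thesis using * by (simp add: in_supp)
  qed
  have "h *s g = h *s (\<Sum>w\<in>supp g. vcoeff g w *s mvec w)"
    using expand_vec[OF finite_supp order_refl supp_monomials, of g] by (rule arg_cong)
  also have "\<dots> = (\<Sum>w\<in>supp g. (h * vcoeff g w) *s mvec w)"
    by (simp add: vec_eq_iff sum_distrib_left mult.assoc)
  finally have hg: "h *s g = (\<Sum>w\<in>supp g. (h * vcoeff g w) *s mvec w)" .
  have "vcoeff (h *s g) u = vcoeff ((h * vcoeff g ?v) *s mvec ?v) u + (\<Sum>w\<in>supp g - {?v}. vcoeff ((h * vcoeff g w) *s mvec w) u)"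
    unfolding hg vcoeff_sum using v(1) finite_supp by (rule sum.remove[rotated])
  also have "(\<Sum>w\<in>supp g - {?v}. vcoeff ((h * vcoeff g w) *s mvec w) u) = 0"
    using lower by (intro sum.neutral) blast
  finally have "vcoeff (h *s g) u = vcoeff ((h * vcoeff g ?v) *s mvec ?v) u" by simp
  moreover have c: "vcoeff g ?v \<in> R - {0}" using v(1) by (simp add: in_supp)
  ultimately have 1: "vcoeff (h *s g) u \<noteq> 0" using lead[OF c] by metis
  have "(y, u) \<in> ord" if "y \<in> supp (h *s g)" for y
  proof -
    have "(\<Sum>w\<in>supp g. vcoeff ((h * vcoeff g w) *s mvec w) y) \<noteq> 0"
      using that unfolding in_supp hg vcoeff_sum .
    then obtain w where "w \<in> supp g" "vcoeff ((h * vcoeff g w) *s mvec w) y \<noteq> 0"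
      by (rule sum.not_neutral_contains_not_neutral)
    then have w: "w \<in> supp g" "y \<in> supp ((h * vcoeff g w) *s mvec w)"
      by (simp_all only: in_supp not_False_eq_True)
    show ?thesis
    proof (cases "w = ?v")
      case True
      then show ?thesis using lead[OF c] w(2) by blast
    next
      case False
      then show ?thesis using lower[OF w(1)] w(2) by blast
    qed
  qed
  with 1 show ?thesis by blast
qed

lemma N_0: "0 \<in> N" and N_add: "f \<in> N \<Longrightarrow> g \<in> N \<Longrightarrow> f + g \<in> N" and N_smult: "f \<in> N \<Longrightarrow> a *s f \<in> N"
  using submodule by (auto simp: left_submodule_def)

section \<open>Normal forms modulo the submodule\<close>

text \<open>
  Well-founded induction on the monomial \<open>u\<close>. The term at \<open>u\<close> is kept if \<open>u\<close> is irreducible, and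
  otherwise it is cancelled by a multiple of an element of \<open>G\<close> with leading monomial \<open>u\<close>.
\<close>

lemma reduce_below_monomial:
  assumes "u \<in> monomials nvars" "\<And>v. v \<in> supp f \<Longrightarrow> (v, u) \<in> ord"
  shows "\<exists>f'. supp f' \<subseteq> IrrG \<and> (\<forall>v\<in>supp f'. (v, u) \<in> ord) \<and> f - f' \<in> N"
  using assms
proof (induction u arbitrary: f rule: wf_induct_rule[OF ord_wf])
  case (1 u)
  \<comment> \<open>If the coefficient of \<open>u\<close> vanishes, the leading monomial is smaller than \<open>u\<close>.\<close>
  have *: "\<exists>f'. supp f' \<subseteq> IrrG \<and> (\<forall>v\<in>supp f'. (v, u) \<in> ord) \<and> f - f' \<in> N"
    if f: "\<And>v. v \<in> supp f \<Longrightarrow> (v, u) \<in> ord" "vcoeff f u = 0" for f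
  proof (cases "f = 0")
    case True
    then show ?thesis by (intro exI[of _ 0]) (simp add: support_def N_0)
  next
    case False
    have l: "LM f \<in> supp f" by (rule LM_supp[OF False])
    then have "(LM f, u) \<in> ord - Id" using f by (auto simp: in_supp)
    moreover have "LM f \<in> monomials nvars" using l supp_monomials by blast
    ultimately obtain f' where "supp f' \<subseteq> IrrG" "\<forall>v\<in>supp f'. (v, LM f) \<in> ord" "f - f' \<in> N"
      using "1.IH"[of "LM f" f] LM_max by blast
    then show ?thesis using f(1)[OF l] ord_trans by blast
  qed
  let ?c = "vcoeff f u"
  show ?case
  proof (cases "u \<in> IrrG")
    case True
    let ?f = "f - ?c *s mvec u"
    have vcoeff: "vcoeff ?f w = (if w = u then 0 else vcoeff f w)" for w
      using vcoeff_mult_R[of ?c "mvec u" w] vcoeff_mvec[OF "1.prems"(1), of w] by (simp add: cf_diff)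
    obtain f' where f': "supp f' \<subseteq> IrrG" "\<forall>v\<in>supp f'. (v, u) \<in> ord" "?f - f' \<in> N"
      using *[of ?f] "1.prems"(2) unfolding in_supp vcoeff by (metis (no_types, lifting))
    have "vcoeff (f' + ?c *s mvec u) w = vcoeff f' w + (if w = u then ?c else 0)" for w
      using vcoeff_mult_R[of ?c "mvec u" w] vcoeff_mvec[OF "1.prems"(1), of w] by (simp add: cf_add)
    then have "supp (f' + ?c *s mvec u) \<subseteq> insert u (supp f')"
      by (auto simp: support_def split: if_splits)
    moreover have "f - (f' + ?c *s mvec u) \<in> N" using f'(3) by (simp add: algebra_simps)
    ultimately show ?thesis
      using f' True ord_refl[OF "1.prems"(1)] by (intro exI[of _ "f' + ?c *s mvec u"]) blast
  next
    case False
    then obtain g where g: "g \<in> G" "rdivides (LM g) u"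
      using "1.prems"(1) by (auto simp: Irr_def)
    then have gN: "g \<in> N" "g \<noteq> 0" using GS by (auto simp: GS_basis_def)
    obtain h where h: "vcoeff (h *s g) u \<noteq> 0" "\<forall>v\<in>supp (h *s g). (v, u) \<in> ord"
      using LM_multiple[OF gN(2) "1.prems"(1) g(2)] by blast
    obtain b where b: "b \<in> R" "b * vcoeff (h *s g) u = 1" using R_inverse[OF cf_R h(1)] by blast
    let ?f = "f - (?c * b) *s (h *s g)"
    have vcoeff: "vcoeff ?f w = vcoeff f w - ?c * b * vcoeff (h *s g) w" for w
      using vcoeff_mult_R[of "?c * b" "h *s g" w] b(1) by (simp add: cf_diff R_mult)
    have "vcoeff ?f u = 0" unfolding vcoeff by (simp only: mult.assoc b(2)) simp
    moreover have "(v, u) \<in> ord" if "v \<in> supp ?f" for v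
    proof -
      have "v \<in> supp f \<or> v \<in> supp (h *s g)"
        using that unfolding in_supp vcoeff by (metis diff_self mult_zero_right)
      then show ?thesis using h(2) "1.prems"(2) by blast
    qed
    ultimately obtain f' where f': "supp f' \<subseteq> IrrG" "\<forall>v\<in>supp f'. (v, u) \<in> ord" "?f - f' \<in> N"
      using *[of ?f] by blast
    have "f - f' = (?f - f') + (?c * b) *s (h *s g)" by simp
    also have "\<dots> \<in> N" by (intro N_add N_smult f' gN)
    finally show ?thesis using f' by blast
  qed
qed

text \<open>
  Reduction never raises the monomial, hence never the total degree. So the irreducible
  monomials account for each degree step of the filtration, not only for \<open>A\<^sup>p / N\<close> as a whole.
\<close>

lemma normal_form:
  assumes "\<And>u. u \<in> supp f \<Longrightarrow> tdeg nvars u \<le> t"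
  shows "\<exists>f'. supp f' \<subseteq> {u \<in> IrrG. tdeg nvars u \<le> t} \<and> f - f' \<in> N"
proof (cases "f = 0")
  case True
  then show ?thesis by (intro exI[of _ 0]) (simp add: support_def N_0)
next
  case False
  have l: "LM f \<in> supp f" by (rule LM_supp[OF False])
  then have "LM f \<in> monomials nvars" using supp_monomials by blast
  then obtain f' where f': "supp f' \<subseteq> IrrG" "\<forall>v\<in>supp f'. (v, LM f) \<in> ord" "f - f' \<in> N"
    using reduce_below_monomial[of "LM f" f] LM_max by blast
  have "tdeg nvars v \<le> t" if "v \<in> supp f'" for v
    using f'(2) that ord_tdeg assms[OF l] le_trans by blast
  then show ?thesis using f' by blast
qed

lemma Irr_independent_mod_N:
  assumes "supp f \<subseteq> IrrG" "f \<in> N"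
  shows "f = 0"
proof (rule ccontr)
  assume "f \<noteq> 0"
  then obtain g where "g \<in> G" "rdivides (LM g) (LM f)"
    using GS assms(2) by (auto simp: GS_basis_def)
  moreover have "LM f \<in> IrrG" using LM_supp[OF \<open>f \<noteq> 0\<close>] assms(1) by blast
  ultimately show False by (auto simp: Irr_def)
qed

end

section \<open>Finite-dimensional pieces of the algebra\<close>

context dd_field_algebra
begin

lemma subspace_below: "subspace (below t)"
  unfolding subspace_def
proof (intro conjI ballI allI below_zero)
  fix a b assume "a \<in> below t" "b \<in> below t"
  then show "a + b \<in> below t" by (rule below_add)
next
  fix c a assume "a \<in> below t"
  then have "scale c 1 * a \<in> below t" by (intro below_mult_R R_scale R_1)
  then show "scale c a \<in> below t" by (simp flip: scale_mult_left)
qed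

lemma subspace_R: "subspace R"
  using R_subalgebra by (simp add: subalgebra_def)

lemma R_basis: "\<exists>B. finite B \<and> independent B \<and> span B = R"
proof -
  obtain B0 where B0: "finite B0" "R = span B0"
    using field_extension by (auto simp: finite_field_extension_def)
  obtain B where B: "B \<subseteq> R" "independent B" "R \<subseteq> span B" "card B = dim R"
    by (rule basis_exists)
  have "finite B" using independent_span_bound[OF B0(1) B(2)] B(1) B0(2) by simp
  moreover have "span B = R" using B span_minimal[OF B(1) subspace_R] by blast
  ultimately show ?thesis using B by blast
qed

lemma dim_R_pos: "dim R > 0"
proof -
  obtain B where B: "finite B" "independent B" "span B = R" using R_basis by blast
  then have "dim R = card B" using dim_span_eq_card_independent by metis
  moreover have "B \<noteq> {}" using B(3) R_1 by (metis span_empty singletonD one_neq_zero)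
  ultimately show ?thesis using B(1) by (simp add: card_gt_0_iff)
qed

lemma below_finite_span: "\<exists>B. finite B \<and> below t = span B"
proof -
  obtain B where B: "finite B" "span B = R" using R_basis by blast
  let ?E = "{\<alpha> \<in> exps nvars. weight \<alpha> < t}"
  let ?Y = "(\<lambda>(b, \<alpha>). b * X \<alpha>) ` (B \<times> ?E)"
  have "?E \<subseteq> exponents_on {1..nvars} t"
    by (auto simp: exps_def exponents_on_def weight_def)
  then have "finite ?E" using finite_card_exponents_on[of "{1..nvars}" t] finite_subset by auto
  then have fin: "finite ?Y" using B(1) by auto
  have "B \<subseteq> R" using span_superset[of B] by (simp only: B(2))
  then have "?Y \<subseteq> below t" by (auto intro!: below_mult_R X_below)
  then have "span ?Y \<subseteq> below t" by (rule span_minimal[OF _ subspace_below])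
  moreover have "a \<in> span ?Y" if "a \<in> below t" for a
    using that
  proof (induction rule: below_induct)
    case (add a b)
    then show ?case by (rule span_add)
  next
    case (monomial r \<alpha>)
    show ?case
    proof (cases "r = 0")
      case False
      then have \<alpha>: "\<alpha> \<in> ?E" using monomial by simp
      have "r \<in> span B" using monomial B by simp
      then show ?thesis
      proof (induction rule: span_induct_alt)
        case (step c b r)
        have "b * X \<alpha> \<in> span ?Y" using step \<alpha> by (intro span_base) force
        then have "scale c (b * X \<alpha>) + r * X \<alpha> \<in> span ?Y"
          using step by (intro span_add span_scale)
        then show ?case by (simp add: distrib_right scale_mult_left)
      qed (simp add: span_zero)
    qed (simp add: span_zero)
  qed
  ultimately show ?thesis using fin by blast
qed

lemma subspace_power_below:
  assumes "V \<subseteq> below (Suc s)"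
  shows "subspace_power V k \<subseteq> below (Suc (s * k))"
proof (induction k)
  case 0
  have "{1} \<subseteq> below (Suc 0)" using R_below[OF R_1] by simp
  then show ?case using span_minimal[OF _ subspace_below] by simp
next
  case (Suc k)
  have "{v * w |v w. v \<in> V \<and> w \<in> subspace_power V k} \<subseteq> below (Suc (s * Suc k))"
  proof clarify
    fix v w assume "v \<in> V" "w \<in> subspace_power V k"
    then have "v * w \<in> below (Suc s + s * k)" using assms Suc by (intro mult_below) auto
    then show "v * w \<in> below (Suc (s * Suc k))" by simp
  qed
  then show ?case using span_minimal[OF _ subspace_below] by simp
qed

text \<open>
  The exponent is positive: the power \<open>0\<close> of a subspace is spanned by \<open>1\<close> over \<open>k\<close> and need not contain
  \<open>R\<close>.
\<close>

lemma word_in_subspace_power: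
  assumes "set js \<subseteq> {1..nvars}" "length js \<le> Suc k" "r \<in> R"
  shows "r * prod_list (map gens js) \<in> subspace_power (below 2) (Suc k)"
  using assms
proof (induction k arbitrary: js r)
  case 0
  have "r * prod_list (map gens js) \<in> below (Suc (length js))"
    using word_mult_below[OF "0.prems"(1) R_below[OF R_1]] "0.prems"(3) by (simp add: below_mult_R)
  then have "r * prod_list (map gens js) \<in> below 2"
    by (rule below_mono) (use "0.prems"(2) in simp)
  moreover have "1 \<in> span {1}" by (simp add: span_base)
  ultimately have "r * prod_list (map gens js) * 1 \<in>
      {v * w |v w. v \<in> below 2 \<and> w \<in> subspace_power (below 2) 0}"
    unfolding subspace_power.simps by blast
  then show ?case by (simp only: subspace_power.simps mult_1_right span_base)
next
  case (Suc k)
  have "\<exists>v\<in>below 2. \<exists>w\<in>subspace_power (below 2) (Suc k). r * prod_list (map gens js) = v * w"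
  proof (cases js)
    case Nil
    have "r \<in> below 2" using R_below[OF Suc.prems(3)] by (rule below_mono) simp
    moreover have "1 * prod_list (map gens []) \<in> subspace_power (below 2) (Suc k)"
      by (rule Suc.IH) auto
    ultimately show ?thesis using Nil
      by (intro bexI[of _ r] bexI[of _ "1 * prod_list (map gens [])"]) simp_all
  next
    case (Cons j js')
    have "gens j * 1 \<in> below (Suc (Suc 0))"
      using Suc.prems(1) Cons by (intro gens_mult_below R_below) auto
    then have "r * gens j \<in> below 2"
      using Suc.prems(3) by (simp add: below_mult_R numeral_2_eq_2)
    moreover have "1 * prod_list (map gens js') \<in> subspace_power (below 2) (Suc k)"
      using Suc.prems Cons by (intro Suc.IH) auto
    ultimately show ?thesis using Cons
      by (intro bexI[of _ "r * gens j"] bexI[of _ "1 * prod_list (map gens js')"])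
        (simp_all add: mult.assoc)
  qed
  then have "r * prod_list (map gens js) \<in>
      {v * w |v w. v \<in> below 2 \<and> w \<in> subspace_power (below 2) (Suc k)}" by blast
  then show ?case unfolding subspace_power.simps(2)[of _ "Suc k"] by (rule span_base)
qed

lemma below_subset_subspace_power:
  assumes "k > 0"
  shows "below (Suc k) \<subseteq> subspace_power (below 2) k"
proof
  obtain k' where k: "k = Suc k'" using assms by (cases k) auto
  fix a assume "a \<in> below (Suc k)"
  then show "a \<in> subspace_power (below 2) k"
  proof (induction rule: below_induct)
    case (add a b)
    then show ?case unfolding k subspace_power.simps by (rule span_add)
  next
    case (monomial r \<alpha>)
    show ?case
    proof (cases "r = 0")
      case True
      then show ?thesis unfolding k subspace_power.simps by (simp add: span_zero)
    next
      case False
      then have "weight \<alpha> \<le> Suc k'" using monomial k by simp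
      then have "r * prod_list (map gens (letters \<alpha> [1..<Suc nvars])) \<in> subspace_power (below 2) (Suc k')"
        using letters_upt[of \<alpha> 1 nvars] monomial(1)
        by (intro word_in_subspace_power) (simp_all add: weight_def del: upt_Suc)
      then show ?thesis using letters_upt(1)[of \<alpha> 1 nvars] by (simp only: k xpow_def)
    qed
  qed
qed

end

section \<open>Dimensions in the quotient module\<close>

context GS_module
begin

definition kscale :: "'k \<Rightarrow> 'a ^ 'p \<Rightarrow> 'a ^ 'p" where "kscale c f = scale c 1 *s f"

lemma kscale_component: "kscale c f $ i = scale c (f $ i)"
  by (simp add: kscale_def flip: scale_mult_left)

sublocale V: vector_space kscale
  by unfold_locales
    (simp_all add: vec_eq_iff kscale_component scale_right_distrib scale_left_distrib)

definition spanned :: "'p monom set \<Rightarrow> ('a ^ 'p) set" where "spanned T = {f. supp f \<subseteq> T}"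
definition bounded_deg :: "nat \<Rightarrow> ('a ^ 'p) set" where
  "bounded_deg t = {f. \<forall>i. f $ i \<in> below (Suc t)}"

abbreviation "IrrT t \<equiv> {u \<in> IrrG. tdeg nvars u \<le> t}"
abbreviation "M \<equiv> quotient_module N"

lemma subspace_spanned: "V.subspace (spanned T)"
  unfolding V.subspace_def
proof (intro conjI ballI allI)
  show "0 \<in> spanned T" by (simp add: spanned_def support_def)
next
  fix f g assume fg: "f \<in> spanned T" "g \<in> spanned T"
  have "supp (f + g) \<subseteq> supp f \<union> supp g" by (auto simp: support_def cf_add)
  then show "f + g \<in> spanned T" using fg by (auto simp: spanned_def)
next
  fix c f assume f: "f \<in> spanned T"
  have "supp (kscale c f) \<subseteq> supp f" by (auto simp: support_def kscale_component cf_scale)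
  then show "kscale c f \<in> spanned T" using f by (auto simp: spanned_def)
qed

lemma subspace_bounded_deg: "V.subspace (bounded_deg t)"
  using subspace_below[of "Suc t"] unfolding V.subspace_def subspace_def bounded_deg_def
  by (simp add: kscale_component)

lemma bounded_deg_iff: "f \<in> bounded_deg t \<longleftrightarrow> (\<forall>u\<in>supp f. tdeg nvars u \<le> t)"
  by (auto simp: bounded_deg_def below_def support_def tdeg_weight less_Suc_eq_le)

lemma finite_IrrT: "finite (IrrT t)" and IrrT_monomials: "IrrT t \<subseteq> monomials nvars"
  using finite_monomials_bounded[of nvars t] by (auto simp: Irr_def elim!: rev_finite_subset)

text \<open>
  The products \<open>b u\<close> with \<open>b\<close> in a \<open>k\<close>-basis of \<open>R\<close> and \<open>u \<in> T\<close> form a \<open>k\<close>-basis.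
\<close>

lemma spanned_basis:
  assumes T: "finite T" "T \<subseteq> monomials nvars"
  shows "\<exists>B. finite B \<and> V.independent B \<and> V.span B = spanned T \<and> card B = dim R * card T"
proof -
  obtain B where B: "finite B" "independent B" "span B = R" using R_basis by blast
  have BR: "b \<in> R" "b \<noteq> 0" if "b \<in> B" for b
    using that B span_base dependent_zero by auto
  let ?\<phi> = "\<lambda>(b, u). b *s mvec u"
  let ?Y = "?\<phi> ` (B \<times> T)"
  have vcoeff: "vcoeff (b *s mvec u) w = (if w = u then b else 0)" if "b \<in> R" "u \<in> T" for b u w
  proof -
    have u: "u \<in> monomials nvars" using that T by blast
    show ?thesis by (simp only: vcoeff_mult_R[OF that(1)] vcoeff_mvec[OF u]) simp
  qed
  have inj: "inj_on ?\<phi> (B \<times> T)"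
  proof (rule inj_onI, clarify)
    fix b u b' u'
    assume *: "b \<in> B" "u \<in> T" "b' \<in> B" "u' \<in> T" and eq: "b *s mvec u = b' *s mvec u'"
    have "b = (if u = u' then b' else 0)"
      using arg_cong[OF eq, of "\<lambda>f. vcoeff f u"] vcoeff[of b u u] vcoeff[of b' u' u] * BR by simp
    then show "b = b' \<and> u = u'" using BR *(1) by (auto split: if_splits)
  qed
  have "V.independent ?Y"
  proof (rule V.independent_if_scalars_zero)
    show "finite ?Y" using T B by auto
  next
    fix c y assume sum0: "(\<Sum>x\<in>?Y. kscale (c x) x) = 0" and y: "y \<in> ?Y"
    then obtain b u where bu: "b \<in> B" "u \<in> T" "y = b *s mvec u" by auto
    have "0 = vcoeff (\<Sum>x\<in>?Y. kscale (c x) x) u" using sum0 by simp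
    also have "(\<Sum>x\<in>?Y. kscale (c x) x) = (\<Sum>x\<in>B \<times> T. kscale (c (?\<phi> x)) (?\<phi> x))"
      by (rule sum.reindex[OF inj, unfolded comp_def])
    also have "\<dots> = (\<Sum>b\<in>B. \<Sum>w\<in>T. kscale (c (b *s mvec w)) (b *s mvec w))"
      by (subst sum.cartesian_product) (intro sum.cong, auto)
    also have "vcoeff \<dots> u = (\<Sum>b\<in>B. \<Sum>w\<in>T. scale (c (b *s mvec w)) (vcoeff (b *s mvec w) u))"
      by (simp only: vcoeff_sum kscale_component cf_scale)
    also have "\<dots> = (\<Sum>b\<in>B. \<Sum>w\<in>T. if u = w then scale (c (b *s mvec w)) b else 0)"
    proof (intro sum.cong refl)
      fix b w assume "b \<in> B" "w \<in> T"
      then have "vcoeff (b *s mvec w) u = (if u = w then b else 0)" using BR by (intro vcoeff)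
      then show "scale (c (b *s mvec w)) (vcoeff (b *s mvec w) u) = (if u = w then scale (c (b *s mvec w)) b else 0)"
        by (rule ssubst) simp
    qed
    also have "\<dots> = (\<Sum>b\<in>B. scale (c (b *s mvec u)) b)"
      using T(1) bu(2) by (simp add: sum.delta')
    finally have "(\<Sum>b\<in>B. scale (c (b *s mvec u)) b) = 0" by simp
    from independentD[OF B(2) B(1) order_refl this bu(1)]
    show "c y = 0" by (simp add: bu(3))
  qed
  moreover have "V.span ?Y = spanned T"
  proof
    have "?Y \<subseteq> spanned T"
      using BR vcoeff by (auto simp: spanned_def in_supp split: if_splits)
    then show "V.span ?Y \<subseteq> spanned T" by (rule V.span_minimal[OF _ subspace_spanned])
  next
    have summand: "r *s mvec u \<in> V.span ?Y" if "r \<in> R" "u \<in> T" for r u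
    proof -
      have "r \<in> span B" using that B by simp
      then show ?thesis
      proof (induction rule: span_induct_alt)
        case base
        have "0 *s mvec u = 0" by (simp add: vec_eq_iff)
        then show ?case by (simp add: V.span_zero)
      next
        case (step c b r)
        have "b *s mvec u \<in> V.span ?Y" using step that by (intro V.span_base) force
        then have "kscale c (b *s mvec u) + r *s mvec u \<in> V.span ?Y"
          using step by (intro V.span_add V.span_scale)
        moreover have "kscale c (b *s mvec u) + r *s mvec u = (scale c b + r) *s mvec u"
          by (simp add: vec_eq_iff kscale_component distrib_right scale_mult_left)
        ultimately show ?case by simp
      qed
    qed
    show "spanned T \<subseteq> V.span ?Y"
    proof
      fix f assume "f \<in> spanned T"
      then have "supp f \<subseteq> T" by (simp add: spanned_def)
      from expand_vec[OF T(1) this T(2)] have "f = (\<Sum>u\<in>T. vcoeff f u *s mvec u)" .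
      also have "\<dots> \<in> V.span ?Y" by (intro V.span_sum summand cf_R)
      finally show "f \<in> V.span ?Y" .
    qed
  qed
  moreover have "card ?Y = dim R * card T"
    using card_image[OF inj] dim_span_eq_card_independent[OF B(2)] B(3)
    by (simp add: card_cartesian_product)
  ultimately show ?thesis using T B by (intro exI[of _ ?Y]) auto
qed

lemma k_space_quotient:
  "carrier (k_space M) = range (coset N)"
  "add (k_space M) (coset N f) (coset N g) = coset N (f + g)"
  "Module.module.smult (k_space M) c (coset N f) = coset N (kscale c f)"
  "zero (k_space M) = coset N 0"
  using quotient_module_add[OF submodule, of f g] quotient_module_smult[OF submodule, of "scale c 1" f]
  by (simp_all add: k_space_def kscale_def quotient_module_zero)
    (simp add: quotient_module_def)

lemma k_span_coset: "k_span M (coset N ` Y) = coset N ` V.span Y"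
  unfolding k_span_def
proof (rule V.module_span_image[where U = UNIV])
  show "Module.module scalar_ring (k_space M)"
    using vectorspace_quotient[OF submodule] by (simp add: vectorspace_def)
qed (auto simp: k_space_quotient)

lemma product_space_coset:
  "product_space M A (coset N ` Y) = coset N ` V.span {a *s f | a f. a \<in> A \<and> f \<in> Y}"
proof -
  have "{Module.module.smult M a f | a f. a \<in> A \<and> f \<in> coset N ` Y} =
      coset N ` {a *s f | a f. a \<in> A \<and> f \<in> Y}"
    using quotient_module_smult[OF submodule] by (auto simp: image_iff) metis+
  then show ?thesis by (simp add: product_space_def k_span_coset)
qed

lemma k_dim_coset:
  assumes B: "finite B" "V.independent B" and inj: "inj_on (coset N) (V.span B)"
  shows "k_dim M (coset N ` V.span B) = card B"
proof -
  let ?W = "coset N ` V.span B"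
  have mod: "Module.module scalar_ring (k_space M)" and vs: "vectorspace scalar_ring (k_space M)"
    using vectorspace_quotient[OF submodule] by (simp_all add: vectorspace_def)
  have "LinearCombinations.submodule scalar_ring ?W (k_space M)"
    unfolding LinearCombinations.submodule_def
    using mod V.span_add V.span_scale
    by (auto simp: k_space_quotient intro!: imageI V.span_zero)
  then have "VectorSpace.subspace scalar_ring ?W (k_space M)"
    using vs by (simp add: VectorSpace.subspace_def)
  then have "vectorspace scalar_ring ((k_space M)\<lparr>carrier := ?W\<rparr>)"
    by (rule vectorspace.subspace_is_vs[OF vs])
  then show ?thesis unfolding k_dim_def
    by (rule V.vectorspace_dim_image) (use B inj in \<open>auto simp: k_space_quotient\<close>)
qed

text \<open>
  The combinations of irreducible monomials form a complement of \<open>N\<close>: they represent classes uniquely,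
  and, by the next lemma, they represent every class without raising the total degree.
\<close>

lemma coset_inj_on_Irr: "inj_on (coset N) (spanned IrrG)"
proof (rule inj_onI)
  fix f g assume fg: "f \<in> spanned IrrG" "g \<in> spanned IrrG" and eq: "coset N f = coset N g"
  have "f - g \<in> spanned IrrG" using fg by (rule V.subspace_diff[OF subspace_spanned])
  moreover have "f - g \<in> N" using eq coset_eq_iff[OF submodule] by blast
  ultimately show "f = g" using Irr_independent_mod_N[of "f - g"] by (simp add: spanned_def)
qed

lemma coset_bounded_deg: "coset N ` bounded_deg t = coset N ` spanned (IrrT t)"
proof
  show "coset N ` bounded_deg t \<subseteq> coset N ` spanned (IrrT t)"
  proof clarify
    fix f assume "f \<in> bounded_deg t"
    then obtain f' where "supp f' \<subseteq> IrrT t" "f - f' \<in> N"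
      using normal_form[of f t] by (auto simp: bounded_deg_iff)
    then show "coset N f \<in> coset N ` spanned (IrrT t)"
      using coset_eq_iff[OF submodule, of f f'] by (auto simp: spanned_def)
  qed
  show "coset N ` spanned (IrrT t) \<subseteq> coset N ` bounded_deg t"
    by (intro image_mono) (auto simp: spanned_def bounded_deg_iff)
qed

lemma k_dim_bounded_deg: "k_dim M (coset N ` bounded_deg t) = dim R * card (IrrT t)"
proof -
  obtain B where B: "finite B" "V.independent B" "V.span B = spanned (IrrT t)"
    "card B = dim R * card (IrrT t)"
    using spanned_basis[OF finite_IrrT IrrT_monomials] by blast
  have "spanned (IrrT t) \<subseteq> spanned IrrG" by (auto simp: spanned_def)
  then have "inj_on (coset N) (V.span B)" unfolding B(3) by (rule inj_on_subset[OF coset_inj_on_Irr])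
  from k_dim_coset[OF B(1,2) this] show ?thesis by (simp add: coset_bounded_deg B(3,4))
qed

text \<open>
  Both subspaces of the quotient are represented inside the complement of \<open>N\<close> spanned by irreducible
  monomials. There the classes correspond one to one to vectors, and the sizes of bases can be
  compared.
\<close>

lemma k_dim_mono:
  assumes Z: "V.subspace Z" "V.subspace Z'" and sub: "coset N ` Z \<subseteq> coset N ` Z'"
    and bound: "coset N ` Z' \<subseteq> coset N ` bounded_deg s"
  shows "k_dim M (coset N ` Z) \<le> k_dim M (coset N ` Z')"
proof -
  have basis: "\<exists>B. finite B \<and> V.independent B \<and>
      V.span B = {f \<in> spanned (IrrT s). coset N f \<in> coset N ` Y} \<and>
      k_dim M (coset N ` Y) = card B"
    if Y: "V.subspace Y" "coset N ` Y \<subseteq> coset N ` bounded_deg s" for Y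
  proof -
    let ?U = "{f \<in> spanned (IrrT s). coset N f \<in> coset N ` Y}"
    have U: "V.subspace ?U"
      unfolding V.subspace_def
    proof (intro conjI ballI allI)
      show "0 \<in> ?U" using V.subspace_0[OF Y(1)] V.subspace_0[OF subspace_spanned] by blast
    next
      fix f g assume "f \<in> ?U" "g \<in> ?U"
      then obtain y z where yz: "y \<in> Y" "z \<in> Y" "coset N f = coset N y" "coset N g = coset N z"
        and fg: "f \<in> spanned (IrrT s)" "g \<in> spanned (IrrT s)" by auto
      have "coset N (f + g) = coset N (y + z)"
        using yz by (simp flip: k_space_quotient(2))
      then show "f + g \<in> ?U"
        using V.subspace_add[OF Y(1) yz(1,2)] V.subspace_add[OF subspace_spanned fg] by blast
    next
      fix c f assume "f \<in> ?U"
      then obtain y where y: "y \<in> Y" "coset N f = coset N y" and f: "f \<in> spanned (IrrT s)" by auto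
      have "coset N (kscale c f) = coset N (kscale c y)"
        using y by (simp flip: k_space_quotient(3))
      then show "kscale c f \<in> ?U"
        using V.subspace_scale[OF Y(1) y(1)] V.subspace_scale[OF subspace_spanned f] by blast
    qed
    obtain C where C: "finite C" "V.independent C" "V.span C = spanned (IrrT s)"
      using spanned_basis[OF finite_IrrT IrrT_monomials] by blast
    obtain B where B: "B \<subseteq> ?U" "V.independent B" "?U \<subseteq> V.span B" "card B = V.dim ?U"
      by (rule V.basis_exists)
    have fin: "finite B" using V.independent_span_bound[OF C(1) B(2)] B(1) C(3) by auto
    have span: "V.span B = ?U" using B V.span_minimal[OF B(1) U] by blast
    have "spanned (IrrT s) \<subseteq> spanned IrrG" by (auto simp: spanned_def)
    then have "inj_on (coset N) (V.span B)"
      unfolding span by (intro inj_on_subset[OF coset_inj_on_Irr]) auto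
    from k_dim_coset[OF fin B(2) this] have "k_dim M (coset N ` ?U) = card B" by (simp only: span)
    moreover have "coset N ` ?U = coset N ` Y"
    proof
      show "coset N ` Y \<subseteq> coset N ` ?U"
      proof clarify
        fix y assume "y \<in> Y"
        then have "coset N y \<in> coset N ` spanned (IrrT s)"
          using Y(2) unfolding coset_bounded_deg by blast
        then obtain f where "f \<in> spanned (IrrT s)" "coset N y = coset N f" by (rule imageE)
        with \<open>y \<in> Y\<close> show "coset N y \<in> coset N ` ?U" by (intro image_eqI[of _ _ f]) auto
      qed
    qed auto
    ultimately show ?thesis using fin B(2) span by metis
  qed
  from basis[OF Z(1) subset_trans[OF sub bound]] obtain B where
    B: "finite B" "V.independent B"
      "V.span B = {f \<in> spanned (IrrT s). coset N f \<in> coset N ` Z}" "k_dim M (coset N ` Z) = card B"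
    by (elim exE conjE)
  from basis[OF Z(2) bound] obtain B' where
    B': "finite B'" "V.independent B'"
      "V.span B' = {f \<in> spanned (IrrT s). coset N f \<in> coset N ` Z'}" "k_dim M (coset N ` Z') = card B'"
    by (elim exE conjE)
  have "B \<subseteq> V.span B'" using V.span_superset[of B] sub unfolding B(3) B'(3) by blast
  then show ?thesis using V.independent_span_bound[OF B'(1) B(2)] B(4) B'(4) by simp
qed

end

section \<open>The Hilbert function and the Gelfand-Kirillov dimension\<close>

context GS_module
begin

text \<open>
  The \<open>k\<close>-span of the standard basis, whose image is the generating space \<open>E\<close> of \<open>A\<^sup>p / N\<close>.
\<close>

definition generators :: "('a ^ 'p) set" where "generators = V.span (range (\<lambda>i. axis i 1))"

lemma generating_space_eq: "generating_space N = coset N ` generators"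
proof -
  have "range (\<lambda>i. coset N (axis i 1)) = coset N ` range (\<lambda>i. axis i 1)" by auto
  then show ?thesis by (simp add: generating_space_def k_span_coset generators_def)
qed

lemma axis_generators: "axis i 1 \<in> generators"
  unfolding generators_def by (rule V.span_base) simp

lemma generators_R:
  assumes "f \<in> generators"
  shows "f $ i \<in> R"
proof -
  have "V.subspace {f. \<forall>i. f $ i \<in> R}"
    using subspace_R unfolding V.subspace_def subspace_def by (simp add: kscale_component)
  moreover have "range (\<lambda>i. axis i 1) \<subseteq> {f. \<forall>i. f $ i \<in> R}"
    by (auto simp: axis_def)
  ultimately have "generators \<subseteq> {f. \<forall>i. f $ i \<in> R}"
    unfolding generators_def by (intro V.span_minimal)
  then show ?thesis using assms by blast
qed

lemma smult_bounded_deg: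
  assumes "a \<in> below (Suc s)" "f \<in> bounded_deg t"
  shows "a *s f \<in> bounded_deg (s + t)"
proof -
  have "a * f $ i \<in> below (Suc s + t)" for i
    using assms by (intro mult_below) (auto simp: bounded_deg_def)
  then show ?thesis by (simp add: bounded_deg_def)
qed

lemma generators_bounded_deg: "generators \<subseteq> bounded_deg 0"
  using R_below generators_R by (auto simp: bounded_deg_def)

lemma vec_eq_sum_axis: "f = (\<Sum>i\<in>UNIV. (f $ i) *s axis i (1 :: 'a))"
  by (simp add: vec_eq_iff axis_def if_distrib[of "\<lambda>c. _ * c"] sum.delta' cong: if_cong)

lemma graded_part_below: "graded_part R nvars gens i \<subseteq> below (Suc i)"
  by (auto simp: graded_part_def left_span_def weight_def
      intro!: below_sum below_mult_R X_below)

lemma graded_part_monomial: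
  assumes "c \<in> R" "\<alpha> \<in> exps nvars"
  shows "c * X \<alpha> \<in> graded_part R nvars gens (weight \<alpha>)"
  unfolding graded_part_def left_span_def
  using assms by (intro CollectI exI[of _ "{X \<alpha>}"] exI[of _ "\<lambda>_. c"]) (auto simp: weight_def)

text \<open>
  The sum of the first components is the image of all vectors of total degree at most \<open>t\<close>, so normal
  forms give its dimension.
\<close>

lemma Hilbert_function_eq:
  "Hilbert_function R nvars gens N t = dim R * card (IrrT t)"
proof -
  define Y where "Y i = V.span {a *s f | a f. a \<in> graded_part R nvars gens i \<and> f \<in> generators}" for i
  have "Hilbert_component R nvars gens N i = coset N ` Y i" for i
    by (simp add: Hilbert_component_def generating_space_eq product_space_coset Y_def)
  then have "k_span M (\<Union>i\<le>t. Hilbert_component R nvars gens N i) = coset N ` V.span (\<Union>i\<le>t. Y i)"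
    by (simp add: k_span_coset flip: image_UN)
  also have "V.span (\<Union>i\<le>t. Y i) = bounded_deg t"
  proof
    have "a *s f \<in> bounded_deg t" if "i \<le> t" "a \<in> graded_part R nvars gens i" "f \<in> generators" for a f i
    proof -
      have "a \<in> below (Suc i)" using that(2) graded_part_below by blast
      then have "a \<in> below (Suc t)" by (rule below_mono) (use that(1) in simp)
      moreover have "f \<in> bounded_deg 0" using that(3) generators_bounded_deg by blast
      ultimately have "a *s f \<in> bounded_deg (t + 0)" by (rule smult_bounded_deg)
      then show ?thesis by simp
    qed
    then have "Y i \<subseteq> bounded_deg t" if "i \<le> t" for i
      unfolding Y_def using that by (intro V.span_minimal subspace_bounded_deg) auto
    then show "V.span (\<Union>i\<le>t. Y i) \<subseteq> bounded_deg t"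
      by (intro V.span_minimal subspace_bounded_deg) auto
  next
    show "bounded_deg t \<subseteq> V.span (\<Union>i\<le>t. Y i)"
    proof
      fix f assume f: "f \<in> bounded_deg t"
      have "vcoeff f u *s mvec u \<in> V.span (\<Union>i\<le>t. Y i)" if u: "u \<in> supp f" for u
      proof -
        have "tdeg nvars u \<le> t" using f u by (simp add: bounded_deg_iff)
        have "u \<in> monomials nvars" using u supp_monomials by blast
        then have "fst u \<in> exps nvars" by (simp add: monomials_def mem_Times_iff)
        then have "vcoeff f u * X (fst u) \<in> graded_part R nvars gens (tdeg nvars u)"
          unfolding tdeg_weight by (intro graded_part_monomial cf_R)
        then have "(vcoeff f u * X (fst u)) *s axis (snd u) 1 \<in> Y (tdeg nvars u)"
          unfolding Y_def using axis_generators by (intro V.span_base) blast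
        moreover have "(vcoeff f u * X (fst u)) *s axis (snd u) 1 = vcoeff f u *s mvec u"
          by (simp add: vec_eq_iff monom_vec_def axis_def)
        ultimately show ?thesis using \<open>tdeg nvars u \<le> t\<close> by (intro V.span_base) auto
      qed
      then have "(\<Sum>u\<in>supp f. vcoeff f u *s mvec u) \<in> V.span (\<Union>i\<le>t. Y i)" by (rule V.span_sum)
      then show "f \<in> V.span (\<Union>i\<le>t. Y i)"
        using expand_vec[OF finite_supp order_refl supp_monomials, of f] by argo
    qed
  qed
  finally show ?thesis by (simp add: Hilbert_function_def k_dim_bounded_deg)
qed

lemma finite_below:
  assumes "finite B"
  shows "\<exists>s. B \<subseteq> below s"
  using assms
proof induction
  case (insert b B)
  then obtain s where s: "B \<subseteq> below s" by blast
  \<comment> \<open>The element \<open>0\<close> is inserted because \<open>Max\<close> of the empty set is unspecified.\<close>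
  define s' where "s' = Suc (Max (insert 0 (weight ` {\<alpha>. cf b \<alpha> \<noteq> 0})))"
  have "b \<in> below s'"
    using finite_cf[of b] by (auto simp: below_def s'_def less_Suc_eq_le intro!: Max_ge)
  then have "insert b B \<subseteq> below (max s s')"
    using s by (auto intro: below_mono)
  then show ?case by blast
qed auto

text \<open>
  A finite-dimensional \<open>V\<close> has bounded degree, say at most \<open>s\<close>, and \<open>F\<close> has representatives of degree
  at most \<open>t\<close>. Products then have degree at most \<open>s k + t\<close>.
\<close>

lemma product_dim_le:
  assumes V: "finite B" and C: "finite C" "C \<subseteq> carrier M"
  shows "\<exists>s t. s > 0 \<and> (\<forall>k. k_dim M (product_space M (subspace_power (span B) k) (k_span M C))
    \<le> dim R * card (IrrT (s * k + t)))"
proof -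
  obtain s0 where "B \<subseteq> below s0" using finite_below[OF V] by blast
  then have "B \<subseteq> below (Suc (Suc s0))" by (meson below_mono le_SucI order_refl subsetD subsetI)
  then have s: "span B \<subseteq> below (Suc (Suc s0))" by (rule span_minimal[OF _ subspace_below])
  obtain Y where Y: "C = coset N ` Y" "finite Y"
    using C finite_subset_image[of C "coset N" UNIV] by (auto simp: quotient_module_def)
  have "finite (\<Union>f\<in>Y. range (\<lambda>i. f $ i))" using Y(2) by auto
  then obtain t where "(\<Union>f\<in>Y. range (\<lambda>i. f $ i)) \<subseteq> below t" using finite_below by blast
  then have "Y \<subseteq> bounded_deg t"
    by (auto simp: bounded_deg_def intro!: below_mono[of _ t "Suc t"])
  then have t: "V.span Y \<subseteq> bounded_deg t" by (rule V.span_minimal[OF _ subspace_bounded_deg])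
  have "k_dim M (product_space M (subspace_power (span B) k) (k_span M C))
    \<le> dim R * card (IrrT (Suc s0 * k + t))" for k
  proof -
    let ?Z = "V.span {a *s f | a f. a \<in> subspace_power (span B) k \<and> f \<in> V.span Y}"
    have "a *s f \<in> bounded_deg (Suc s0 * k + t)"
      if "a \<in> subspace_power (span B) k" "f \<in> V.span Y" for a f
      using that subspace_power_below[OF s, of k] t by (intro smult_bounded_deg) auto
    then have "?Z \<subseteq> bounded_deg (Suc s0 * k + t)"
      by (intro V.span_minimal subspace_bounded_deg) auto
    then have "k_dim M (coset N ` ?Z) \<le> k_dim M (coset N ` bounded_deg (Suc s0 * k + t))"
      by (intro k_dim_mono[OF V.subspace_span subspace_bounded_deg _ order_refl] image_mono)
    moreover have "product_space M (subspace_power (span B) k) (k_span M C) = coset N ` ?Z"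
      unfolding Y(1) k_span_coset by (rule product_space_coset)
    ultimately show ?thesis by (simp only: k_dim_bounded_deg)
  qed
  then show ?thesis by blast
qed

text \<open>
  The elements of degree at most \<open>1\<close> generate the filtration: every element of degree at most \<open>k\<close> is
  a sum of products of \<open>k\<close> of them.
\<close>

lemma product_dim_ge:
  assumes "k > 0"
  shows "dim R * card (IrrT k) \<le>
    k_dim M (product_space M (subspace_power (below 2) k) (generating_space N))"
proof -
  let ?Z = "V.span {a *s f | a f. a \<in> subspace_power (below 2) k \<and> f \<in> generators}"
  have "f \<in> ?Z" if "f \<in> bounded_deg k" for f
  proof -
    have "(f $ i) *s axis i 1 \<in> ?Z" for i
      using that below_subset_subspace_power[OF assms] axis_generators[of i]
      by (intro V.span_base) (auto simp: bounded_deg_def)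
    then have "(\<Sum>i\<in>UNIV. (f $ i) *s axis i 1) \<in> ?Z" by (rule V.span_sum)
    then show ?thesis using vec_eq_sum_axis[of f] by argo
  qed
  then have "bounded_deg k \<subseteq> ?Z" by blast
  moreover have "?Z \<subseteq> bounded_deg k"
  proof (intro V.span_minimal subspace_bounded_deg, clarify)
    fix a f assume "a \<in> subspace_power (below 2) k" "f \<in> generators"
    then have "a \<in> below (Suc (1 * k))" "f \<in> bounded_deg 0"
      using subspace_power_below[of "below 2" 1 k] generators_bounded_deg by (auto simp: numeral_2_eq_2)
    then show "a *s f \<in> bounded_deg k" using smult_bounded_deg[of a k f 0] by simp
  qed
  ultimately have "?Z = bounded_deg k" by blast
  then have "product_space M (subspace_power (below 2) k) (generating_space N) = coset N ` bounded_deg k"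
    by (simp add: generating_space_eq product_space_coset)
  then show ?thesis by (simp add: k_dim_bounded_deg)
qed

text \<open>
  For any choice of \<open>V\<close> and \<open>F\<close> the growth is bounded by that of \<open>H (s k + t)\<close>, where \<open>H\<close> is the Hilbert
  function, and for one choice it is at least that of \<open>H\<close>. Both have the exponent \<open>deg h\<close>.
\<close>

lemma GKdim_eq:
  fixes h :: "rat poly"
  assumes h: "\<And>t. t \<ge> t0 \<Longrightarrow> of_nat (dim R * card (IrrT t)) = poly h (of_nat t)"
    and pos: "h \<noteq> 0 \<Longrightarrow> lead_coeff h > 0"
  shows "GKdim M = edegree h"
proof -
  let ?H = "\<lambda>t. dim R * card (IrrT t)"
  have growth: "limsup (\<lambda>k. elog k (?H (c * k + d))) = edegree h" if "c > 0" for c d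
    using elog_growth[of t0 ?H h c d, OF h that pos] by (intro lim_imp_Limsup) auto
  show ?thesis
    unfolding GKdim_def
  proof (rule antisym)
    show "(SUP (V, F)\<in>{(V, F). 1 \<in> V \<and> (\<exists>B. finite B \<and> V = span B) \<and>
          (\<exists>C. finite C \<and> C \<subseteq> carrier M \<and> F = k_span M C)}.
        limsup (\<lambda>k. elog k (k_dim M (product_space M (subspace_power V k) F)))) \<le> edegree h"
    proof (rule SUP_least)
      fix VF assume "VF \<in> {(V, F). 1 \<in> V \<and> (\<exists>B. finite B \<and> V = span B) \<and>
          (\<exists>C. finite C \<and> C \<subseteq> carrier M \<and> F = k_span M C)}"
      then obtain B C where VF: "VF = (span B, k_span M C)"
        and BC: "finite B" "finite C" "C \<subseteq> carrier M" by blast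
      from product_dim_le[OF BC] obtain s t where s: "s > 0"
        and le: "\<And>k. k_dim M (product_space M (subspace_power (span B) k) (k_span M C)) \<le> ?H (s * k + t)"
        by blast
      have "limsup (\<lambda>k. elog k (k_dim M (product_space M (subspace_power (span B) k) (k_span M C))))
          \<le> limsup (\<lambda>k. elog k (?H (s * k + t)))"
        by (rule Limsup_mono) (use eventually_ge_at_top[of 2] in eventually_elim, rule elog_mono[OF le])
      then show "(case VF of (V, F) \<Rightarrow>
          limsup (\<lambda>k. elog k (k_dim M (product_space M (subspace_power V k) F)))) \<le> edegree h"
        using growth[OF s] by (simp add: VF)
    qed
  next
    have "edegree h = limsup (\<lambda>k. elog k (?H (1 * k + 0)))" by (rule growth[symmetric]) simp
    also have "\<dots> \<le> limsup (\<lambda>k. elog k (k_dim M (product_space M (subspace_power (below 2) k) (generating_space N))))"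
    proof (rule Limsup_mono)
      show "\<forall>\<^sub>F k in sequentially. elog k (?H (1 * k + 0)) \<le>
          elog k (k_dim M (product_space M (subspace_power (below 2) k) (generating_space N)))"
        using eventually_ge_at_top[of 2]
        by eventually_elim (rule elog_mono, use product_dim_ge in auto)
    qed
    also have "\<dots> \<le> (SUP (V, F)\<in>{(V, F). 1 \<in> V \<and> (\<exists>B. finite B \<and> V = span B) \<and>
          (\<exists>C. finite C \<and> C \<subseteq> carrier M \<and> F = k_span M C)}.
        limsup (\<lambda>k. elog k (k_dim M (product_space M (subspace_power V k) F))))"
    proof (rule SUP_upper2[of "(below 2, generating_space N)"])
      have "1 \<in> below 2" using R_below[OF R_1] by (rule below_mono) simp
      moreover have "\<exists>C. finite C \<and> C \<subseteq> carrier M \<and> generating_space N = k_span M C"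
        unfolding generating_space_def
        by (intro exI[of _ "range (\<lambda>i. coset N (axis i 1))"]) (auto simp: quotient_module_def)
      ultimately show "(below 2, generating_space N) \<in> {(V, F). 1 \<in> V \<and> (\<exists>B. finite B \<and> V = span B) \<and>
          (\<exists>C. finite C \<and> C \<subseteq> carrier M \<and> F = k_span M C)}"
        using below_finite_span[of 2] by auto
    qed simp
    finally show "edegree h \<le> (SUP (V, F)\<in>{(V, F). 1 \<in> V \<and> (\<exists>B. finite B \<and> V = span B) \<and>
          (\<exists>C. finite C \<and> C \<subseteq> carrier M \<and> F = k_span M C)}.
        limsup (\<lambda>k. elog k (k_dim M (product_space M (subspace_power V k) F))))" .
  qed
qed

text \<open>
  Capping the exponents at \<open>q\<close> does not affect divisibility by a monomial with exponents at most \<open>q\<close>.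
\<close>

lemma Irr_shape:
  assumes q: "\<And>g i. g \<in> G \<Longrightarrow> i \<in> {1..nvars} \<Longrightarrow> fst (LM g) i \<le> q" and u: "u \<in> monomials nvars"
  shows "u \<in> IrrG \<longleftrightarrow> shape q u \<in> IrrG"
proof -
  have "rdivides (LM g) u \<longleftrightarrow> rdivides (LM g) (shape q u)" if "g \<in> G" for g
  proof -
    have "g \<noteq> 0" using that GS by (auto simp: GS_basis_def)
    then have "LM g \<in> monomials nvars" using LM_supp supp_monomials by blast
    then have "fst (LM g) i \<le> q" for i
      using q[OF that, of i] by (cases "i \<in> {1..nvars}") (auto simp: monomials_def exps_def)
    then show ?thesis by (simp add: rdivides_def shape_def)
  qed
  moreover have "shape q u \<in> monomials nvars"
    using u by (auto simp: monomials_def exps_def shape_def)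
  ultimately show ?thesis using u by (simp add: Irr_def)
qed

end

lemma rat_poly_eqI_nat:
  fixes h h' :: "rat poly"
  assumes "\<And>t. t \<ge> t0 \<Longrightarrow> poly h (of_nat t) = poly h' (of_nat t)"
  shows "h = h'"
proof (rule ccontr)
  assume "h \<noteq> h'"
  then have "finite {x. poly (h - h') x = 0}" by (intro poly_roots_finite) simp
  moreover have "of_nat ` {t0..} \<subseteq> {x. poly (h - h') x = 0}" using assms by auto
  ultimately have "finite ((of_nat :: nat \<Rightarrow> rat) ` {t0..})" by (rule finite_subset[rotated])
  then have "finite {t0..}" by (rule finite_imageD) (simp add: inj_on_def)
  then show False using infinite_Ici by blast
qed

section \<open>The dimension of a finitely generated module\<close>

theorem theorem6p2:
  fixes scale :: "'k::field_char_0 \<Rightarrow> 'a::ring_1 \<Rightarrow> 'a"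
    and R :: "'a set" and m n l q :: nat
    and S D x :: "nat \<Rightarrow> 'a" and \<sigma> \<delta> :: "nat \<Rightarrow> 'a \<Rightarrow> 'a"
    and N G :: "('a ^ 'p::finite) set"
    and r :: "('p monom \<times> 'p monom) set"
  assumes "dd_algebra scale R m n S D \<sigma> \<delta>"
    and "k_algebra.finite_field_extension scale R"
    and l: "l = m + n" and x: "x = dd_gens m S D"
    and "left_submodule N"
    and "DD_ordering R l x r" and "total_degree_ordering l r"
    and "finite G" and "GS_basis R l x r N G"
    and q: "q = Max (insert 0 {fst (lm R l x r g) i | g i. g \<in> G \<and> i \<in> {1..l}})"
  shows "(\<exists>!h :: rat poly. \<forall>t\<ge>l * q.
             of_nat (k_algebra.Hilbert_function scale R l x N t) = poly h (of_nat t)) \<and>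
         (\<forall>h :: rat poly.
            (\<forall>t\<ge>l * q. of_nat (k_algebra.Hilbert_function scale R l x N t) = poly h (of_nat t)) \<longrightarrow>
              k_algebra.GKdim scale (quotient_module N) = edegree h \<and>
              (\<forall>t\<ge>l * q. edegree h =
                 emax {card (top_indices l q u) | u.
                         u \<in> Irr R l x r G \<and> tdeg l u \<le> t \<and> shape q u = u}))"
proof -
  interpret GS_module scale R m n S D \<sigma> \<delta> N G r
    using assms by (simp add: GS_module_def dd_field_algebra_def GS_module_axioms_def
        dd_field_algebra_axioms_def)
  have "{fst (LM g) i | g i. g \<in> G \<and> i \<in> {1..nvars}} = (\<lambda>(g, i). fst (LM g) i) ` (G \<times> {1..nvars})"
    by (auto, blast)
  then have "finite {fst (LM g) i | g i. g \<in> G \<and> i \<in> {1..nvars}}"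
    using finite_G by simp
  then have bound: "fst (LM g) i \<le> q" if "g \<in> G" "i \<in> {1..nvars}" for g i
    unfolding q l x using that by (intro Max_ge) auto
  have "IrrG \<subseteq> monomials nvars" by (auto simp: Irr_def)
  then obtain h :: "rat poly" where
    h: "\<And>t. nvars * q \<le> t \<Longrightarrow> of_nat (dim R * card (IrrT t)) = poly h (of_nat t)"
    and pos: "h \<noteq> 0 \<Longrightarrow> lead_coeff h > 0"
    and deg: "edegree h = emax {card (top_indices nvars q u) | u. u \<in> IrrG \<and> shape q u = u}"
    using counting_polynomial[of IrrG nvars "dim R" q] dim_R_pos Irr_shape[OF bound] by blast
  \<comment> \<open>For \<open>t \<ge> l * q\<close> the degree bound holds for every shape.\<close>
  have top: "{card (top_indices nvars q u) | u. u \<in> IrrG \<and> tdeg nvars u \<le> t \<and> shape q u = u} =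
      {card (top_indices nvars q u) | u. u \<in> IrrG \<and> shape q u = u}" if "nvars * q \<le> t" for t
    using that tdeg_shape_le[of nvars q] by (metis (no_types, lifting) le_trans)
  have unique: "h' = h"
    if "\<forall>t\<ge>nvars * q. of_nat (Hilbert_function R nvars gens N t) = poly h' (of_nat t)" for h'
    using that h unfolding Hilbert_function_eq by (intro rat_poly_eqI_nat[of "nvars * q"]) simp
  have GK: "GKdim M = edegree h" by (rule GKdim_eq[OF h pos])
  show ?thesis
    unfolding l x
  proof (intro conjI allI impI ex1I[of _ h])
    fix t assume "nvars * q \<le> t"
    then show "of_nat (Hilbert_function R nvars gens N t) = poly h (of_nat t)"
      unfolding Hilbert_function_eq by (rule h)
  next
    fix h' :: "rat poly" and t assume "\<forall>t\<ge>nvars * q. of_nat (Hilbert_function R nvars gens N t) = poly h' (of_nat t)"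
      and t: "nvars * q \<le> t"
    then have "h' = h" by (intro unique) simp
    then show "edegree h' = emax {card (top_indices nvars q u) | u.
        u \<in> IrrG \<and> tdeg nvars u \<le> t \<and> shape q u = u}"
      by (simp only: deg top[OF t])
  qed (use unique GK in auto)
qed

end
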